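(* (1) Let $c > 0$. Then we can find $f(c) > 0$ such that for $k = [ n \log n + c n ]$ we have $d_{TV}\left(\left(\frac {1}{np}{\bf B}_1\right)^k, U\right)=f(c) + o(1)$ as $n \to \infty$, where $f(c) \le e^{-c} + {\cal O}(e^{-2c})$ as $c \to \infty$. (2) Suppose $\{ c_n \}_n$ satisfy $\log \left\{ \log (np)\cdot\log n \right\}\le c_n \ll \log n$, where $a_n \ll b_n$ means $\lim_{n \to \infty}\frac {a_n}{b_n} = 0$. Let $k := [n \log n - c_n \cdot n]$. Then for any $\delta > 0$, we have $d_{TV}\left(\left(\frac {1}{np}{\bf B}_1\right)^k, U\right)\ge 1 - {\cal O}\left(\frac {1}{n^{1/2 - \delta}}\right)$ as $n \to \infty$.
   Context: $G_{n,p}=C_p\wr\mathfrak S_n$ is the colored permutation group (pairs $(s,\sigma)$, $s\in C_p^n$, $\sigma\in\mathfrak S_n$, product $(t,\tau)(s,\sigma)=(\sigma t+s,\tau\sigma)$, $\sigma t=(t_{\sigma(1)},\ldots,t_{\sigma(n)})$), whose elements are regarded as words $(s_1,\sigma(1))\cdots(s_n,\sigma(n))$ over $C_p\times[n]$. For words $u,v$, $u\sqcup\!\sqcup v$ is the shuffle product (formal sum of all interleavings). With $W_{1,n}=(0,2)(0,3)\cdots(0,n)$, ${\mathbf B}_1=\sum_{j=0}^{p-1}(j,1)\sqcup\!\sqcup W_{1,n}\in{\mathbb Q}G_{n,p}$, so $\frac{1}{np}{\mathbf B}_1$ is the probability distribution of the top-to-random shuffle on $G_{n,p}$ and its $k$-th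 power (in the group algebra) is the distribution after $k$ shuffles. $U=\sum_{w\in G_{n,p}}\frac{1}{p^n n!}w$ is the uniform distribution, and for probability distributions ${\bf P},{\bf Q}\in{\mathbb R}G_{n,p}$, $d_{TV}({\bf P},{\bf Q})=\frac12|{\bf P}-{\bf Q}|$ with $|\sum c_w w|=\sum|c_w|$. $[x]$ denotes the integer part. *)

theory Defs
  imports
    Complex_Main
    "HOL-Library.Multiset"
    "HOL-Library.FuncSet"
    "HOL-Library.Landau_Symbols"
    "HOL-Combinatorics.Permutations"
    "HOL-Algebra.Elementary_Groups"
    "HOL-Algebra.Module"
begin

text \<open>Elements are pairs \<open>(s, \<sigma>)\<close> with \<open>s \<in> C\<^sub>p\<^sup>n\<close> and \<open>\<sigma>\<close> a permutation of \<open>{1..n}\<close>.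
  The product is \<open>(t, \<tau>) (s, \<sigma>) = (\<sigma>t + s, \<tau>\<sigma>)\<close> where \<open>\<sigma>t = (t\<^bsub>\<sigma>(1)\<^esub>, \<dots>, t\<^bsub>\<sigma>(n)\<^esub>)\<close>. Tuples are
  extensional functions on \<open>{1..n}\<close>, so that equality on the carrier is equality of tuples.
  For \<open>p = 0\<close> the group \<^term>\<open>integer_mod_group p\<close> is infinite; only \<open>p \<ge> 1\<close> is meant.\<close>

definition colored_perm_group :: "nat \<Rightarrow> nat \<Rightarrow> ((nat \<Rightarrow> int) \<times> (nat \<Rightarrow> nat)) monoid" where
  "colored_perm_group n p =
     \<lparr>carrier = ({1..n} \<rightarrow>\<^sub>E carrier (integer_mod_group p)) \<times> {\<sigma>. \<sigma> permutes {1..n}},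
      monoid.mult = (\<lambda>(t, \<tau>) (s, \<sigma>).
        (\<lambda>i\<in>{1..n}. t (\<sigma> i) \<otimes>\<^bsub>integer_mod_group p\<^esub> s i, \<tau> \<circ> \<sigma>)),
      one = (\<lambda>i\<in>{1..n}. \<one>\<^bsub>integer_mod_group p\<^esub>, id)\<rparr>"

definition word_of :: "nat \<Rightarrow> (nat \<Rightarrow> int) \<times> (nat \<Rightarrow> nat) \<Rightarrow> (int \<times> nat) list" where
  "word_of n = (\<lambda>(s, \<sigma>). map (\<lambda>i. (s i, \<sigma> i)) [1..<Suc n])"

text \<open>A formal sum of words with natural coefficients is a multiset of words. The library's
  \<^const>\<open>shuffles\<close> only yields the set of interleavings, without multiplicities.\<close>

fun shuffle_prod :: "'a list \<Rightarrow> 'a list \<Rightarrow> 'a list multiset" where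
  "shuffle_prod [] v = {#v#}"
| "shuffle_prod u [] = {#u#}"
| "shuffle_prod (x # u) (y # v) =
     image_mset ((#) x) (shuffle_prod u (y # v)) + image_mset ((#) y) (shuffle_prod (x # u) v)"

lemma set_mset_shuffle_prod: "set_mset (shuffle_prod u v) = shuffles u v"
  by (induction u v rule: shuffle_prod.induct) auto

lemma size_shuffle_prod: "size (shuffle_prod u v) = (length u + length v) choose length u"
  by (induction u v rule: shuffle_prod.induct) auto

text \<open>The real group algebra: finitely supported coefficient functions with convolution.\<close>

definition group_algebra :: "('g, 'm) monoid_scheme \<Rightarrow> (real, 'g \<Rightarrow> real) module" where
  "group_algebra G =
     \<lparr>carrier = {f. finite {x. f x \<noteq> 0} \<and> {x. f x \<noteq> 0} \<subseteq> carrier G},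
      monoid.mult = (\<lambda>f h x. \<Sum>a | f a \<noteq> 0. \<Sum>b | h b \<noteq> 0. if a \<otimes>\<^bsub>G\<^esub> b = x then f a * h b else 0),
      one = (\<lambda>x. if x = \<one>\<^bsub>G\<^esub> then 1 else 0),
      zero = (\<lambda>x. 0),
      add = (\<lambda>f h x. f x + h x),
      smult = (\<lambda>r f x. r * f x)\<rparr>"

text \<open>A formal sum of words, as an element of the group algebra of \<^term>\<open>colored_perm_group n p\<close>.\<close>

definition word_sum :: "nat \<Rightarrow> nat \<Rightarrow> (int \<times> nat) list multiset
    \<Rightarrow> (nat \<Rightarrow> int) \<times> (nat \<Rightarrow> nat) \<Rightarrow> real" where
  "word_sum n p M =
     (\<lambda>g. if g \<in> carrier (colored_perm_group n p) then real (count M (word_of n g)) else 0)"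

definition W1 :: "nat \<Rightarrow> (int \<times> nat) list" where
  "W1 n = map (\<lambda>i. (0, i)) [2..<Suc n]"

definition B1 :: "nat \<Rightarrow> nat \<Rightarrow> (nat \<Rightarrow> int) \<times> (nat \<Rightarrow> nat) \<Rightarrow> real" where
  "B1 n p = word_sum n p (\<Sum>j\<in>{0..<int p}. shuffle_prod [(j, 1)] (W1 n))"

definition top_to_random :: "nat \<Rightarrow> nat \<Rightarrow> (nat \<Rightarrow> int) \<times> (nat \<Rightarrow> nat) \<Rightarrow> real" where
  "top_to_random n p = (1 / real (n * p)) \<odot>\<^bsub>group_algebra (colored_perm_group n p)\<^esub> B1 n p"

definition uniform_dist :: "nat \<Rightarrow> nat \<Rightarrow> (nat \<Rightarrow> int) \<times> (nat \<Rightarrow> nat) \<Rightarrow> real" where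
  "uniform_dist n p =
     (\<lambda>g. if g \<in> carrier (colored_perm_group n p) then 1 / (real p ^ n * fact n) else 0)"

definition d_TV :: "('g, 'm) monoid_scheme \<Rightarrow> ('g \<Rightarrow> real) \<Rightarrow> ('g \<Rightarrow> real) \<Rightarrow> real" where
  "d_TV G P Q = (1 / 2) * (\<Sum>w\<in>carrier G. \<bar>P w - Q w\<bar>)"

definition tv_after_shuffles :: "nat \<Rightarrow> nat \<Rightarrow> nat \<Rightarrow> real" where
  "tv_after_shuffles n p k =
     d_TV (colored_perm_group n p)
       (top_to_random n p [^]\<^bsub>group_algebra (colored_perm_group n p)\<^esub> k) (uniform_dist n p)"

lemma group_colored_perm_group: "group (colored_perm_group n p)"
proof (rule groupI, goal_cases)
  case (1 x y)
  obtain t \<tau> where x: "x = (t, \<tau>)" by (cases x)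
  obtain s \<sigma> where y: "y = (s, \<sigma>)" by (cases y)
  have "t (\<sigma> i) \<otimes>\<^bsub>integer_mod_group p\<^esub> s i \<in> carrier (integer_mod_group p)" if "i \<in> {1..n}" for i
  proof -
    have "\<sigma> i \<in> {1..n}"
      using 1 that permutes_in_image[of \<sigma> "{1..n}" i] by (simp add: y colored_perm_group_def)
    then have "t (\<sigma> i) \<in> carrier (integer_mod_group p)" "s i \<in> carrier (integer_mod_group p)"
      using 1 that by (auto simp: x y colored_perm_group_def PiE_def Pi_def simp del: atLeastAtMost_iff)
    then show ?thesis
      by (intro monoid.m_closed group.is_monoid group_integer_mod_group)
  qed
  moreover have "\<tau> \<circ> \<sigma> permutes {1..n}"
    using 1 by (auto simp: x y colored_perm_group_def intro: permutes_compose)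
  ultimately show ?case
    by (simp add: x y colored_perm_group_def)
next
  case 2
  then show ?case
    by (simp add: colored_perm_group_def permutes_id)
next
  case (3 x y z)
  obtain u \<upsilon> t \<tau> s \<sigma> where xyz: "x = (u, \<upsilon>)" "y = (t, \<tau>)" "z = (s, \<sigma>)"
    by (metis prod.exhaust)
  have "\<sigma> i \<in> {1..n} \<longleftrightarrow> i \<in> {1..n}" for i
    using 3 permutes_in_image[of \<sigma> "{1..n}" i] by (simp add: xyz colored_perm_group_def)
  then show ?case
    by (auto simp: xyz colored_perm_group_def fun_eq_iff restrict_def mod_add_left_eq
        mod_add_right_eq add.assoc simp del: atLeastAtMost_iff)
next
  case (4 x)
  obtain s \<sigma> where x: "x = (s, \<sigma>)" by (cases x)
  have s: "s \<in> {1..n} \<rightarrow>\<^sub>E carrier (integer_mod_group p)"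
    using 4 by (simp add: x colored_perm_group_def)
  have "\<sigma> i \<in> {1..n} \<longleftrightarrow> i \<in> {1..n}" for i
    using 4 permutes_in_image[of \<sigma> "{1..n}" i] by (simp add: x colored_perm_group_def)
  moreover have "s i mod int p = s i" if "i \<in> {1..n}" for i
    using s that
    by (auto simp: carrier_integer_mod_group PiE_def Pi_def split: if_splits simp del: atLeastAtMost_iff)
  ultimately show ?case
    using s by (auto simp: x colored_perm_group_def fun_eq_iff restrict_def PiE_def extensional_def
        simp del: atLeastAtMost_iff)
next
  case (5 x)
  obtain s \<sigma> where x: "x = (s, \<sigma>)" by (cases x)
  have \<sigma>: "\<sigma> permutes {1..n}"
    using 5 by (simp add: x colored_perm_group_def)
  have s: "s i \<in> carrier (integer_mod_group p)" if "i \<in> {1..n}" for i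
    using 5 that by (auto simp: x colored_perm_group_def PiE_def Pi_def simp del: atLeastAtMost_iff)
  have inv_in: "inv\<^bsub>integer_mod_group p\<^esub> (s i) \<in> carrier (integer_mod_group p)" if "i \<in> {1..n}" for i
    by (intro group.inv_closed group_integer_mod_group s that)
  have inv_l: "inv\<^bsub>integer_mod_group p\<^esub> (s i) \<otimes>\<^bsub>integer_mod_group p\<^esub> s i = \<one>\<^bsub>integer_mod_group p\<^esub>"
    if "i \<in> {1..n}" for i
    by (intro group.l_inv group_integer_mod_group s that)
  have perm: "inv_into UNIV \<sigma> i \<in> {1..n} \<longleftrightarrow> i \<in> {1..n}" "\<sigma> i \<in> {1..n} \<longleftrightarrow> i \<in> {1..n}"
    "inv_into UNIV \<sigma> (\<sigma> i) = i" for i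
    using permutes_in_image[OF permutes_inv[OF \<sigma>]] permutes_in_image[OF \<sigma>]
      permutes_inverses(2)[OF \<sigma>] by auto
  let ?y = "(\<lambda>i\<in>{1..n}. inv\<^bsub>integer_mod_group p\<^esub> (s (inv_into UNIV \<sigma> i)), inv_into UNIV \<sigma>)"
  have "?y \<in> carrier (colored_perm_group n p)"
    using \<sigma> perm inv_in by (auto simp: colored_perm_group_def permutes_inv
        simp del: atLeastAtMost_iff inv_integer_mod_group mult_integer_mod_group)
  moreover have "?y \<otimes>\<^bsub>colored_perm_group n p\<^esub> x = \<one>\<^bsub>colored_perm_group n p\<^esub>"
    using perm inv_l
    by (auto simp: x colored_perm_group_def restrict_def fun_eq_iff
        simp del: atLeastAtMost_iff inv_integer_mod_group mult_integer_mod_group)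
  ultimately show ?case by blast
qed

lemma card_colored_perm_group:
  assumes "p \<ge> 1"
  shows "card (carrier (colored_perm_group n p)) = p ^ n * fact n"
  using assms
  by (simp add: colored_perm_group_def card_cartesian_product card_PiE carrier_integer_mod_group
      card_permutations)

end

theory Submission
  imports Defs "HOL-Analysis.Uniform_Limit" "HOL-Real_Asymp.Real_Asymp"
begin

text \<open>Multiplying by \<^term>\<open>B1 n p\<close> moves the top card to a random place and recolors it. Cards that have
  never been on top still form an increasing run of color 0 at the end of the alphabet, and given
  that exactly \<open>j\<close> cards are untouched after \<open>k\<close> steps, the arrangement is uniform on the set \<open>D j\<close>
  of words whose \<open>j\<close> largest letters are increasing and of color 0. The number of untouched
  cards is the number of empty boxes after throwing \<open>k\<close> balls into \<open>n\<close> boxes. Since the sets \<open>D j\<close>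
  decrease and \<open>|D j| = p\<^sup>n n! / (p\<^sup>j j!)\<close>, the total variation distance is an explicit function
  of the distribution of that number.

  For \<open>k = n ln n + c n\<close> it tends to the Poisson distribution of mean \<open>\<mu> = e\<^sup>-\<^sup>c\<close>, and the limiting distance
  is at most the Poisson probability \<open>1 - e\<^sup>-\<^sup>\<mu> \<le> \<mu>\<close> of a positive value. For \<open>k = n ln n - c n\<close>,
  the event \<open>D J\<close> with \<open>J = \<lceil>ln n\<rceil>\<close> separates the two distributions: under the uniform one it has probability
  at most \<open>1 / J! = O(1/n)\<close>, while fewer than \<open>J\<close> empty boxes have superpolynomially
  small probability by a Chernoff bound.\<close>

section \<open>Empty boxes in the occupancy problem\<close>

text \<open>The probability that exactly \<open>j\<close> of \<open>n\<close> boxes stay empty after \<open>k\<close> balls, by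
  inclusion-exclusion. Terms with \<open>r < j\<close> vanish, and \<open>(-1)\<^bsup>r + j\<^esup>\<close> stands for \<open>(-1)\<^bsup>r - j\<^esup>\<close>.\<close>

definition empty_prob :: "nat \<Rightarrow> nat \<Rightarrow> nat \<Rightarrow> real" where
  "empty_prob n k j =
     (\<Sum>r\<le>n. (-1) ^ (r + j) * real (r choose j) * real (n choose r) * (1 - real r / real n) ^ k)"

lemma empty_prob_eq_0: "n < j \<Longrightarrow> empty_prob n k j = 0"
  by (auto simp: empty_prob_def intro!: sum.neutral)

text \<open>From \<open>(n choose r) (r choose j) = (n choose j) ((n - j) choose (r - j))\<close>
  there remains the alternating sum of row \<open>n - j\<close> of Pascal's triangle, which is 0
  unless \<open>n = j\<close>.\<close>

lemma empty_prob_0: "empty_prob n 0 j = (if j = n then 1 else 0)"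
proof (cases "j \<le> n")
  case True
  have "empty_prob n 0 j = (\<Sum>r\<in>{j..n}. (-1) ^ (r + j) * real (r choose j) * real (n choose r))"
    unfolding empty_prob_def by (intro sum.mono_neutral_cong_right) auto
  also have "\<dots> = (\<Sum>i\<in>{..n - j}. (-1) ^ (i + j + j) * real ((i + j) choose j) * real (n choose (i + j)))"
    using True by (intro sum.reindex_bij_witness[where i = "\<lambda>i. i + j" and j = "\<lambda>r. r - j"]) auto
  also have "\<dots> = (\<Sum>i\<in>{..n - j}. real (n choose j) * ((-1) ^ i * real ((n - j) choose i)))"
  proof (intro sum.cong refl)
    fix i assume "i \<in> {..n - j}"
    then have "(n choose (i + j)) * ((i + j) choose j) = (n choose j) * ((n - j) choose i)"
      using choose_mult[of j "i + j" n] True by simp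
    then have "real (n choose (i + j)) * real ((i + j) choose j) = real (n choose j) * real ((n - j) choose i)"
      by (metis of_nat_mult)
    then show "(-1) ^ (i + j + j) * real ((i + j) choose j) * real (n choose (i + j))
        = real (n choose j) * ((-1) ^ i * real ((n - j) choose i))"
      by (simp add: power_add mult_ac flip: power_mult_distrib)
  qed
  also have "\<dots> = real (n choose j) * (\<Sum>i\<le>n - j. (-1) ^ i * real ((n - j) choose i))"
    by (simp add: sum_distrib_left)
  also have "\<dots> = (if j = n then 1 else 0)"
    using choose_alternating_sum[of "n - j", where ?'a = real] True by auto
  finally show ?thesis .
qed (auto simp: empty_prob_eq_0)

text \<open>This is the transition law of the number of empty boxes: a ball hits one of
  \<open>j\<close> empty boxes with probability \<open>j / n\<close>. It holds term by term in
  \<open>r\<close>, because \<open>(r - j) (r choose j) = Suc j (r choose Suc j)\<close> absorbs the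
  new factor \<open>1 - r / n\<close>.\<close>

lemma empty_prob_Suc:
  assumes "n \<ge> 1"
  shows "empty_prob n (Suc k) j =
    (1 - real j / real n) * empty_prob n k j + real (Suc j) / real n * empty_prob n k (Suc j)"
proof -
  have "real (r choose j) * (1 - real r / real n) =
      (1 - real j / real n) * real (r choose j) - real (Suc j) / real n * real (r choose Suc j)" for r
  proof -
    have "real (Suc j) * real (r choose Suc j) = (real r - real j) * real (r choose j)"
    proof -
      have "real (Suc r * (r choose j)) = real ((Suc r choose Suc j) * Suc j)"
        by (simp only: Suc_times_binomial_eq)
      then show ?thesis by (simp add: algebra_simps)
    qed
    then have "real (Suc j) / real n * real (r choose Suc j) = (real r - real j) * real (r choose j) / real n"
      by simp
    then show ?thesis by (simp add: algebra_simps diff_divide_distrib)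
  qed
  then have *: "(-1) ^ (r + j) * real (r choose j) * real (n choose r) * (1 - real r / real n) ^ Suc k
      = (1 - real j / real n) * ((-1) ^ (r + j) * real (r choose j) * real (n choose r) * (1 - real r / real n) ^ k)
      + real (Suc j) / real n * ((-1) ^ (r + Suc j) * real (r choose Suc j) * real (n choose r) * (1 - real r / real n) ^ k)"
    for r
  proof -
    have "(-1) ^ (r + j) * real (r choose j) * real (n choose r) * (1 - real r / real n) ^ Suc k
      = (-1) ^ (r + j) * (real (r choose j) * (1 - real r / real n)) * real (n choose r) * (1 - real r / real n) ^ k"
      by simp
    also note \<open>real (r choose j) * (1 - real r / real n) = _\<close>
    finally show ?thesis by (simp add: algebra_simps)
  qed
  show ?thesis
    unfolding empty_prob_def sum_distrib_left sum.distrib[symmetric] by (intro sum.cong refl *)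
qed

text \<open>The alternating sum hides the sign, but the recursion has nonnegative coefficients for
  \<open>j \<le> n\<close>.\<close>

lemma empty_prob_nonneg:
  assumes "n \<ge> 1"
  shows "empty_prob n k j \<ge> 0"
proof (induction k arbitrary: j)
  case (Suc k)
  show ?case
  proof (cases "j \<le> n")
    case True
    then show ?thesis using assms Suc by (auto simp: empty_prob_Suc intro!: add_nonneg_nonneg mult_nonneg_nonneg)
  qed (simp add: empty_prob_eq_0)
qed (simp add: empty_prob_0)

text \<open>The recursion in dual form: one more ball acts on the test function \<open>g\<close> by
  averaging. At \<open>j = 0\<close> the truncated \<open>j - 1\<close> is harmless, since its
  coefficient is 0.\<close>

lemma sum_empty_prob_Suc:
  fixes g :: "nat \<Rightarrow> real"
  assumes "n \<ge> 1"
  shows "(\<Sum>j\<le>n. empty_prob n (Suc k) j * g j) =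
    (\<Sum>j\<le>n. empty_prob n k j * ((1 - real j / real n) * g j + real j / real n * g (j - 1)))"
proof -
  let ?h = "\<lambda>j. real j / real n * empty_prob n k j * g (j - 1)"
  have "(\<Sum>j\<le>n. ?h (Suc j)) = (\<Sum>j\<le>Suc n. ?h j)"
    by (subst sum.atMost_Suc_shift) simp
  also have "\<dots> = (\<Sum>j\<le>n. ?h j)" by (simp add: empty_prob_eq_0)
  finally show ?thesis
    by (simp add: empty_prob_Suc[OF assms] distrib_left distrib_right sum.distrib mult_ac)
qed

lemma sum_empty_prob:
  assumes "n \<ge> 1"
  shows "(\<Sum>j\<le>n. empty_prob n k j) = 1"
proof (induction k)
  case (Suc k)
  then show ?case using sum_empty_prob_Suc[OF assms, of k "\<lambda>_. 1"] by simp
qed (simp add: empty_prob_0)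

text \<open>Bernoulli's inequality bounds the effect of one ball on the generating function by the
  substitution of \<open>1 - (1 - s) (1 - 1/n)\<close> for \<open>s\<close>, so \<open>k\<close> balls replace \<open>1 - s\<close> by
  \<open>(1 - s) (1 - 1/n)\<^sup>k\<close>.\<close>

lemma empty_prob_gf_le:
  assumes "n \<ge> 1" "0 < s" "s \<le> 1"
  shows "(\<Sum>j\<le>n. empty_prob n k j * s ^ j) \<le> (1 - (1 - s) * (1 - 1 / real n) ^ k) ^ n"
  using assms(2,3)
proof (induction k arbitrary: s)
  case (Suc k)
  define s' where "s' = s + (1 - s) / real n"
  have s': "0 < s'" "s' \<le> 1"
  proof -
    have "0 \<le> (1 - s) / real n" "(1 - s) / real n \<le> 1 - s"
      using Suc.prems assms(1) mult_left_mono[of 1 "real n" "1 - s"] by (auto simp: field_simps)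
    then show "0 < s'" "s' \<le> 1" using Suc.prems by (auto simp: s'_def intro: add_pos_nonneg)
  qed
  have "(1 - real j / real n) * s ^ j + real j / real n * s ^ (j - 1) \<le> s' ^ j" for j
  proof (cases j)
    case (Suc i)
    \<comment> \<open>Chosen so that \<open>s * (1 + x) = s'\<close>; the division is why
      \<open>s\<close> is kept positive.\<close>
    define x where "x = (1 - s) / (real n * s)"
    have "x \<ge> 0" using Suc.prems assms by (auto simp: x_def \<open>0 < s\<close> \<open>s \<le> 1\<close> less_imp_le)
    then have "1 + real j * x \<le> (1 + x) ^ j" by (intro Bernoulli_inequality) linarith
    then have "s ^ j * (1 + real j * x) \<le> s ^ j * (1 + x) ^ j"
      using Suc.prems \<open>0 < s\<close> by (intro mult_left_mono) auto
    also have "\<dots> = s' ^ j"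
      using \<open>0 < s\<close> assms(1) by (simp add: s'_def x_def field_simps flip: power_mult_distrib)
    also have "s ^ j * (1 + real j * x) = (1 - real j / real n) * s ^ j + real j / real n * s ^ (j - 1)"
      using \<open>0 < s\<close> assms(1) by (simp add: Suc x_def field_simps)
    finally show ?thesis .
  qed simp
  then have "(\<Sum>j\<le>n. empty_prob n (Suc k) j * s ^ j) \<le> (\<Sum>j\<le>n. empty_prob n k j * s' ^ j)"
    unfolding sum_empty_prob_Suc[OF assms(1)]
    by (intro sum_mono mult_left_mono empty_prob_nonneg assms)
  also have "\<dots> \<le> (1 - (1 - s') * (1 - 1 / real n) ^ k) ^ n"
    by (rule Suc.IH) (use s' in auto)
  also have "(1 - s') = (1 - s) * (1 - 1 / real n)"
    using assms(1) by (simp add: s'_def field_simps)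
  finally show ?case by (simp add: mult_ac)
qed (simp add: empty_prob_0 if_distrib[of "\<lambda>x. x * _"] cong: if_cong)

section \<open>Binomial moments of the number of empty boxes near the cutoff\<close>

text \<open>A bound uniform in \<open>n\<close> and summable over \<open>r\<close>, to dominate the
  inclusion-exclusion terms. It combines \<open>1 - x \<le> exp (- x)\<close> with
  \<open>n choose r \<le> n ^ r / r!\<close>. The \<open>- 1\<close> in the hypothesis leaves room
  for the integer part and costs a factor \<open>exp (r / n) \<le> exp r\<close>.\<close>

lemma choose_times_power_le:
  assumes "n \<ge> 1" "r \<le> n" "real n * ln (real n) + c * real n - 1 \<le> real k"
  shows "real (n choose r) * (1 - real r / real n) ^ k \<le> exp ((1 - c) * real r) / fact r"
proof -
  have "(1 - real r / real n) ^ k \<le> exp (- (real r / real n)) ^ k"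
    using assms exp_ge_add_one_self[of "- (real r / real n)"] by (intro power_mono) (auto simp: field_simps)
  also have "\<dots> = exp (- (real r / real n) * real k)" by (simp add: mult.commute flip: exp_of_nat_mult)
  also have "\<dots> \<le> exp (- (real r / real n) * (real n * ln (real n) + c * real n - 1))"
    using mult_left_mono[OF assms(3), of "real r / real n"] by simp
  also have "- (real r / real n) * (real n * ln (real n) + c * real n - 1) = - real r * ln n - c * r + r / n"
    using assms by (simp add: field_simps)
  also have "exp (- real r * ln n - c * r + r / n) \<le> exp (- real r * ln n - c * r + r)"
    using assms mult_right_mono[of 1 "real n" "real r"] by (simp add: field_simps)
  also have "\<dots> = exp ((1 - c) * real r) / real n ^ r"
    using assms by (simp add: algebra_simps exp_add exp_diff exp_minus exp_of_nat_mult divide_inverse)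
  finally have 1: "(1 - real r / real n) ^ k \<le> exp ((1 - c) * real r) / real n ^ r" .
  have "real ((n choose r) * fact r) \<le> real (n ^ r)"
    using binomial_fact_pow of_nat_le_iff by blast
  then have 2: "real (n choose r) \<le> real n ^ r / fact r"
    by (simp add: field_simps)
  have "real (n choose r) * (1 - real r / real n) ^ k
      \<le> (real n ^ r / fact r) * (exp ((1 - c) * real r) / real n ^ r)"
    using assms by (intro mult_mono 1 2) auto
  then show ?thesis using assms by simp
qed

text \<open>The left side is the expectation of \<open>X choose r\<close> for the number
  \<open>X\<close> of empty boxes, and the limit is the same moment of a Poisson variable of mean
  \<open>exp (- c)\<close>.\<close>

lemma choose_times_power_tendsto:
  fixes c :: real and k :: "nat \<Rightarrow> nat"
  assumes k: "\<And>n. k n = nat \<lfloor>real n * ln (real n) + c * real n\<rfloor>"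
  shows "(\<lambda>n. real (n choose r) * (1 - real r / real n) ^ k n) \<longlonglongrightarrow> exp (- c) ^ r / fact r"
proof (cases "r = 0")
  case False
  define K where "K = (\<lambda>n. real n * ln (real n) + c * real n)"
  have K1: "real (k n) \<le> K n" if "K n \<ge> 0" for n
    using that unfolding k K_def by linarith
  have K2: "K n - 1 \<le> real (k n)" for n unfolding k K_def by linarith
  have Kpos: "\<forall>\<^sub>F n in sequentially. K n \<ge> 0" unfolding K_def by real_asymp
  have lt: "\<forall>\<^sub>F n in sequentially. r < n" by (rule eventually_gt_at_top)
  \<comment> \<open>The integer part puts \<open>k n\<close> between \<open>K n - 1\<close> and
    \<open>K n\<close> for large \<open>n\<close>. The powers with these real exponents have the
    same limit and enclose the wanted one, since the base lies in (0, 1).\<close>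
  have lim: "(\<lambda>n. real n ^ r * (1 - real r / real n) powr K n) \<longlonglongrightarrow> exp (- c) ^ r"
    "(\<lambda>n. real n ^ r * (1 - real r / real n) powr (K n - 1)) \<longlonglongrightarrow> exp (- c) ^ r"
  proof -
    have "(\<lambda>n. real n powr r * (1 - real r / real n) powr K n) \<longlonglongrightarrow> exp (- c * r)"
      "(\<lambda>n. real n powr r * (1 - real r / real n) powr (K n - 1)) \<longlonglongrightarrow> exp (- c * r)"
      unfolding K_def using False by real_asymp+
    moreover have "exp (- c * r) = exp (- c) ^ r" by (simp add: mult.commute flip: exp_of_nat_mult)
    moreover have "real n powr r = real n ^ r" for n using False by (simp add: powr_realpow')
    ultimately show "(\<lambda>n. real n ^ r * (1 - real r / real n) powr K n) \<longlonglongrightarrow> exp (- c) ^ r"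
      "(\<lambda>n. real n ^ r * (1 - real r / real n) powr (K n - 1)) \<longlonglongrightarrow> exp (- c) ^ r" by simp_all
  qed
  have "(\<lambda>n. real n ^ r * (1 - real r / real n) ^ k n) \<longlonglongrightarrow> exp (- c) ^ r"
  proof (rule tendsto_sandwich[OF _ _ lim])
    show "\<forall>\<^sub>F n in sequentially. real n ^ r * (1 - real r / real n) powr K n \<le> real n ^ r * (1 - real r / real n) ^ k n"
      using Kpos lt
    proof eventually_elim
      case (elim n)
      have "(1 - real r / real n) powr K n \<le> (1 - real r / real n) powr real (k n)"
        using elim K1 by (intro powr_mono') auto
      then show ?case using elim by (simp add: powr_realpow mult_left_mono)
    qed
    show "\<forall>\<^sub>F n in sequentially. real n ^ r * (1 - real r / real n) ^ k n \<le> real n ^ r * (1 - real r / real n) powr (K n - 1)"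
      using lt
    proof eventually_elim
      case (elim n)
      have "(1 - real r / real n) powr real (k n) \<le> (1 - real r / real n) powr (K n - 1)"
        using elim K2 by (intro powr_mono') auto
      then show ?case using elim by (simp add: powr_realpow mult_left_mono)
    qed
  qed
  moreover have "(\<lambda>n. real (n choose r) / real n ^ r) \<longlonglongrightarrow> 1 / fact r"
  proof -
    have "(\<lambda>n. (\<Prod>i = 0..<r. (real n - real i) / real n) / fact r) \<longlonglongrightarrow> (\<Prod>i = 0..<r. 1) / fact r"
    proof (intro tendsto_intros)
      show "(\<lambda>n. (real n - real i) / real n) \<longlonglongrightarrow> 1" for i by real_asymp
    qed simp
    then show ?thesis
      by (simp add: binomial_gbinomial gbinomial_prod_rev prod_dividef divide_simps mult_ac)
  qed
  ultimately have "(\<lambda>n. real n ^ r * (1 - real r / real n) ^ k n * (real (n choose r) / real n ^ r))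
      \<longlonglongrightarrow> exp (- c) ^ r * (1 / fact r)" by (rule tendsto_mult)
  then show ?thesis
    by (rule Lim_transform_eventually[THEN tendsto_eq_rhs])
       (use lt in \<open>auto elim!: eventually_mono\<close>)
qed simp

section \<open>One shuffle as a convolution\<close>

text \<open>Solving \<open>a \<otimes> b = x\<close> for \<open>a\<close> leaves a single sum over
  the group.\<close>

lemma group_algebra_mult:
  fixes G (structure)
  assumes "group G" and fin: "finite (carrier G)"
    and f: "\<And>x. x \<notin> carrier G \<Longrightarrow> f x = 0" and h: "\<And>x. x \<notin> carrier G \<Longrightarrow> h x = 0"
    and x: "x \<in> carrier G"
  shows "(f \<otimes>\<^bsub>group_algebra G\<^esub> h) x = (\<Sum>b\<in>carrier G. f (x \<otimes>\<^bsub>G\<^esub> inv\<^bsub>G\<^esub> b) * h b)"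
proof -
  interpret group G by fact
  have "(f \<otimes>\<^bsub>group_algebra G\<^esub> h) x =
      (\<Sum>a\<in>carrier G. \<Sum>b\<in>carrier G. if a \<otimes> b = x then f a * h b else 0)"
  proof -
    have "(\<Sum>b | h b \<noteq> 0. if a \<otimes> b = x then f a * h b else 0) =
        (\<Sum>b\<in>carrier G. if a \<otimes> b = x then f a * h b else 0)" for a
      using h by (intro sum.mono_neutral_cong_left fin) auto
    then have "(f \<otimes>\<^bsub>group_algebra G\<^esub> h) x =
        (\<Sum>a | f a \<noteq> 0. \<Sum>b\<in>carrier G. if a \<otimes> b = x then f a * h b else 0)"
      by (simp add: group_algebra_def)
    also have "\<dots> = (\<Sum>a\<in>carrier G. \<Sum>b\<in>carrier G. if a \<otimes> b = x then f a * h b else 0)"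
      using f by (intro sum.mono_neutral_cong_left fin) (auto intro!: sum.neutral split: if_splits)
    finally show ?thesis .
  qed
  also have "\<dots> = (\<Sum>b\<in>carrier G. \<Sum>a\<in>carrier G. if a = x \<otimes> inv b then f a * h b else 0)"
  proof (subst sum.swap, intro sum.cong refl)
    fix a b assume "a \<in> carrier G" "b \<in> carrier G"
    then have "a \<otimes> b = x \<longleftrightarrow> a = x \<otimes> inv b"
      using x inv_solve_right[of a x b] by auto
    then show "(if a \<otimes> b = x then f a * h b else 0) = (if a = x \<otimes> inv b then f a * h b else 0)"
      by simp
  qed
  also have "\<dots> = (\<Sum>b\<in>carrier G. f (x \<otimes> inv b) * h b)"
    using x by (intro sum.cong refl) (simp add: fin)
  finally show ?thesis .
qed

lemma group_algebra_mult_outside: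
  fixes G (structure)
  assumes "group G" and f: "\<And>x. x \<notin> carrier G \<Longrightarrow> f x = 0" and h: "\<And>x. x \<notin> carrier G \<Longrightarrow> h x = 0"
    and x: "x \<notin> carrier G"
  shows "(f \<otimes>\<^bsub>group_algebra G\<^esub> h) x = 0"
proof -
  interpret group G by fact
  have "a \<otimes> b \<noteq> x" if "f a \<noteq> 0" "h b \<noteq> 0" for a b
  proof -
    have "a \<in> carrier G" "b \<in> carrier G" using that f h by blast+
    then show ?thesis using x by auto
  qed
  then show ?thesis
    by (auto simp: group_algebra_def intro!: sum.neutral)
qed

section \<open>Insertions as the terms of the shuffle product\<close>

lemma shuffle_prod_single:
  "shuffle_prod [x] v = image_mset (\<lambda>i. take i v @ x # drop i v) (mset_set {..length v})"
proof (induction v)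
  case (Cons y v)
  have "{..length (y # v)} = insert 0 (Suc ` {..length v})"
    by (simp add: atMost_Suc_eq_insert_0)
  moreover have "mset_set (Suc ` {..length v}) = image_mset Suc (mset_set {..length v})"
    by (rule image_mset_mset_set[symmetric]) simp
  ultimately show ?case
    using Cons by (simp add: multiset.map_comp o_def)
qed simp

text \<open>Right multiplication by \<open>insertion n m c\<close> moves the first letter of a word to position \<open>m\<close>
  and adds \<open>c\<close> to its color.\<close>

definition insertion :: "nat \<Rightarrow> nat \<Rightarrow> int \<Rightarrow> (nat \<Rightarrow> int) \<times> (nat \<Rightarrow> nat)" where
  "insertion n m c = (\<lambda>i\<in>{1..n}. if i = m then c else 0,
     \<lambda>i. if 1 \<le> i \<and> i < m then Suc i else if i = m then 1 else i)"

lemma length_W1 [simp]: "length (W1 n) = n - 1"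
  by (cases n) (simp_all add: W1_def del: upt_Suc)

lemma nth_W1: "i < n - 1 \<Longrightarrow> W1 n ! i = (0, i + 2)"
  by (simp add: W1_def del: upt_Suc)

text \<open>Identifies the interleaving that has \<open>(c, 1)\<close> at the zero-based place
  \<open>m - 1\<close> as the word of a group element, so that the shuffle product can be read
  inside the group.\<close>

lemma word_of_insertion:
  assumes "m \<in> {1..n}"
  shows "word_of n (insertion n m c) = take (m - 1) (W1 n) @ (c, 1) # drop (m - 1) (W1 n)"
proof (rule nth_equalityI)
  show "length (word_of n (insertion n m c)) = length (take (m - 1) (W1 n) @ (c, 1) # drop (m - 1) (W1 n))"
    using assms by (auto simp: word_of_def insertion_def min_def)
  fix i assume "i < length (word_of n (insertion n m c))"
  then have i: "i < n" by (simp add: word_of_def insertion_def del: upt_Suc)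
  then have "word_of n (insertion n m c) ! i =
      (if Suc i = m then c else 0, if i + 1 < m then i + 2 else if Suc i = m then 1 else Suc i)"
    by (simp add: word_of_def insertion_def nth_append del: upt_Suc)
  also have "\<dots> = (take (m - 1) (W1 n) @ (c, 1) # drop (m - 1) (W1 n)) ! i"
  proof (cases "i < m - 1")
    case True
    then have "i + 1 < m" "i < n - 1" using assms by auto
    then show ?thesis using True assms by (simp add: nth_append nth_W1)
  next
    case False
    show ?thesis
    proof (cases "i = m - 1")
      case True
      then show ?thesis using i assms by (auto simp: nth_append)
    next
      case *: False
      then have "(take (m - 1) (W1 n) @ (c, 1) # drop (m - 1) (W1 n)) ! i = drop (m - 1) (W1 n) ! (i - m)"
        using False i assms by (auto simp: nth_append nth_Cons' min_def)
      then show ?thesis using False * i assms by (auto simp: nth_W1)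
    qed
  qed
  finally show "word_of n (insertion n m c) ! i = (take (m - 1) (W1 n) @ (c, 1) # drop (m - 1) (W1 n)) ! i" .
qed

lemma carrier_colored_perm_group:
  assumes "p \<ge> 1"
  shows "carrier (colored_perm_group n p) = ({1..n} \<rightarrow>\<^sub>E {0..<int p}) \<times> {\<sigma>. \<sigma> permutes {1..n}}"
  using assms by (simp add: colored_perm_group_def carrier_integer_mod_group)

lemma finite_colored_perm_group:
  assumes "p \<ge> 1"
  shows "finite (carrier (colored_perm_group n p))"
  using assms by (simp add: carrier_colored_perm_group finite_PiE finite_permutations)

lemma insertion_in_carrier:
  assumes "p \<ge> 1" "m \<in> {1..n}" "c \<in> {0..<int p}"
  shows "insertion n m c \<in> carrier (colored_perm_group n p)"
proof -
  let ?f = "\<lambda>i. if 1 \<le> i \<and> i < m then Suc i else if i = m then 1 else i"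
  have inj: "inj_on ?f {1..n}"
    by (auto simp: inj_on_def split: if_splits)
  have "?f ` {1..n} \<subseteq> {1..n}"
    using assms by (auto split: if_splits)
  then have "?f ` {1..n} = {1..n}"
    by (intro endo_inj_surj inj) auto
  with inj have "bij_betw ?f {1..n} {1..n}"
    unfolding bij_betw_def by blast
  then have "?f permutes {1..n}"
    using assms by (intro bij_imp_permutes) auto
  then show ?thesis
    using assms by (simp add: carrier_colored_perm_group insertion_def restrict_PiE_iff)
qed

lemma word_of_inj_on:
  assumes "p \<ge> 1"
  shows "inj_on (word_of n) (carrier (colored_perm_group n p))"
proof (rule inj_onI)
  fix x y
  assume *: "x \<in> carrier (colored_perm_group n p)" "y \<in> carrier (colored_perm_group n p)"
    "word_of n x = word_of n y"
  obtain s \<sigma> t \<tau> where xy: "x = (s, \<sigma>)" "y = (t, \<tau>)" by (metis prod.exhaust)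
  have eq: "s i = t i \<and> \<sigma> i = \<tau> i" if "i \<in> {1..n}" for i
  proof -
    have "word_of n x ! (i - 1) = word_of n y ! (i - 1)" using *(3) by simp
    moreover have "i - 1 < n" "Suc (i - 1) = i" using that by auto
    ultimately show ?thesis by (simp add: xy word_of_def del: upt_Suc)
  qed
  have "s = t" using * assms eq
    by (intro PiE_ext[of s "{1..n}" _ t]) (auto simp: xy carrier_colored_perm_group)
  moreover have "\<sigma> = \<tau>"
  proof
    fix i show "\<sigma> i = \<tau> i"
      using * assms eq by (cases "i \<in> {1..n}") (auto simp: xy carrier_colored_perm_group permutes_not_in)
  qed
  ultimately show "x = y" by (simp add: xy)
qed

lemma count_image_mset_set:
  "finite A \<Longrightarrow> count (image_mset f (mset_set A)) y = (\<Sum>i\<in>A. if f i = y then 1 else 0)"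
  by (induction A rule: finite_induct) auto

text \<open>Passes from a count of words to a count of group elements: \<open>word_of n\<close> is
  injective on the carrier, so each interleaving matches its insertion and nothing else.\<close>

lemma B1_eq:
  assumes "p \<ge> 1" "n \<ge> 1"
  shows "B1 n p g = (\<Sum>c\<in>{0..<int p}. \<Sum>m\<in>{1..n}. if insertion n m c = g then 1 else 0)"
proof (cases "g \<in> carrier (colored_perm_group n p)")
  case True
  have "real (count (shuffle_prod [(c, 1)] (W1 n)) (word_of n g)) =
      (\<Sum>m\<in>{1..n}. if insertion n m c = g then 1 else 0)" if c: "c \<in> {0..<int p}" for c
  proof -
    let ?w = "\<lambda>i. take i (W1 n) @ (c, 1) # drop i (W1 n)"
    have "{..length (W1 n)} = {0..n - 1}" by (auto simp: W1_def)
    then have "count (shuffle_prod [(c, 1)] (W1 n)) (word_of n g) =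
        (\<Sum>i\<in>{0..n - 1}. if ?w i = word_of n g then 1 else 0)"
      by (simp only: shuffle_prod_single count_image_mset_set[OF finite_atLeastAtMost])
    also have "\<dots> = (\<Sum>m\<in>{1..n}. if word_of n (insertion n m c) = word_of n g then 1 else 0)"
      using assms by (intro sum.reindex_bij_witness[where i = "\<lambda>m. m - 1" and j = Suc])
        (auto simp: word_of_insertion)
    also have "\<dots> = (\<Sum>m\<in>{1..n}. if insertion n m c = g then 1 else 0)"
    proof (intro sum.cong refl)
      fix m assume "m \<in> {1..n}"
      then have "word_of n (insertion n m c) = word_of n g \<longleftrightarrow> insertion n m c = g"
        using insertion_in_carrier[OF assms(1) _ c] True by (intro inj_on_eq_iff[OF word_of_inj_on[OF assms(1)]])
      then show "(if word_of n (insertion n m c) = word_of n g then 1 else 0)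
          = (if insertion n m c = g then 1 else 0)" by simp
    qed
    finally show ?thesis by (simp add: if_distrib[of real] cong: if_cong)
  qed
  then show ?thesis using True by (simp add: B1_def word_sum_def count_sum)
next
  case False
  then have "insertion n m c \<noteq> g" if "m \<in> {1..n}" "c \<in> {0..<int p}" for m c
    using insertion_in_carrier[OF assms(1) that] by auto
  then show ?thesis using False by (simp add: B1_def word_sum_def)
qed

text \<open>All mass of the shuffle sits on insertions, so one step averages \<open>f\<close> over
  the predecessors of \<open>x\<close>, one for each pair \<open>(m, c)\<close>.\<close>

lemma mult_top_to_random:
  fixes n p
  defines "G \<equiv> colored_perm_group n p"
  assumes "p \<ge> 1" "n \<ge> 1" and f: "\<And>x. x \<notin> carrier G \<Longrightarrow> f x = 0" and x: "x \<in> carrier G"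
  shows "(f \<otimes>\<^bsub>group_algebra G\<^esub> top_to_random n p) x =
    (\<Sum>m\<in>{1..n}. \<Sum>c\<in>{0..<int p}. f (x \<otimes>\<^bsub>G\<^esub> inv\<^bsub>G\<^esub> insertion n m c)) / real (n * p)"
proof -
  let ?h = "top_to_random n p"
  have h: "?h b = (\<Sum>c\<in>{0..<int p}. \<Sum>m\<in>{1..n}. (if insertion n m c = b then 1 else 0) / real (n * p))" for b
    by (simp add: top_to_random_def group_algebra_def B1_eq[OF assms(2,3)] sum_divide_distrib)
  have h0: "?h b = 0" if "b \<notin> carrier G" for b
    using that by (simp add: top_to_random_def group_algebra_def B1_def word_sum_def G_def)
  have fin: "finite (carrier G)"
    unfolding G_def using assms(2) by (rule finite_colored_perm_group)
  have "(f \<otimes>\<^bsub>group_algebra G\<^esub> ?h) x = (\<Sum>b\<in>carrier G. f (x \<otimes>\<^bsub>G\<^esub> inv\<^bsub>G\<^esub> b) * ?h b)"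
    by (rule group_algebra_mult[OF _ fin f h0 x]) (auto simp: G_def group_colored_perm_group)
  also have "\<dots> = (\<Sum>b\<in>carrier G. \<Sum>c\<in>{0..<int p}. \<Sum>m\<in>{1..n}.
      (if insertion n m c = b then f (x \<otimes>\<^bsub>G\<^esub> inv\<^bsub>G\<^esub> b) / real (n * p) else 0))"
    unfolding h sum_distrib_left by (intro sum.cong refl) auto
  also have "\<dots> = (\<Sum>c\<in>{0..<int p}. \<Sum>m\<in>{1..n}. \<Sum>b\<in>carrier G.
      (if insertion n m c = b then f (x \<otimes>\<^bsub>G\<^esub> inv\<^bsub>G\<^esub> b) / real (n * p) else 0))"
    by (subst sum.swap) (rule sum.cong[OF refl], rule sum.swap)
  also have "\<dots> = (\<Sum>c\<in>{0..<int p}. \<Sum>m\<in>{1..n}. f (x \<otimes>\<^bsub>G\<^esub> inv\<^bsub>G\<^esub> insertion n m c) / real (n * p))"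
  proof (intro sum.cong refl)
    fix c m assume "c \<in> {0..<int p}" "m \<in> {1..n}"
    then have "insertion n m c \<in> carrier G"
      unfolding G_def using assms(2) by (intro insertion_in_carrier)
    then show "(\<Sum>b\<in>carrier G. (if insertion n m c = b then f (x \<otimes>\<^bsub>G\<^esub> inv\<^bsub>G\<^esub> b) / real (n * p) else 0))
        = f (x \<otimes>\<^bsub>G\<^esub> inv\<^bsub>G\<^esub> insertion n m c) / real (n * p)"
      by (simp add: fin)
  qed
  also have "\<dots> = (\<Sum>m\<in>{1..n}. \<Sum>c\<in>{0..<int p}. f (x \<otimes>\<^bsub>G\<^esub> inv\<^bsub>G\<^esub> insertion n m c)) / real (n * p)"
    by (subst sum.swap) (simp add: sum_divide_distrib)
  finally show ?thesis .
qed

section \<open>Words with a sorted tail\<close>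

text \<open>The condition \<open>n < \<tau> i + j\<close> says that \<open>\<tau> i\<close> is one of the \<open>j\<close> largest letters. Requiring
  \<open>j \<le> n\<close> makes the sets decrease to the empty set at \<open>j = n + 1\<close>.\<close>

definition tail_sorted :: "nat \<Rightarrow> nat \<Rightarrow> nat \<Rightarrow> ((nat \<Rightarrow> int) \<times> (nat \<Rightarrow> nat)) set" where
  "tail_sorted n p j = {(t, \<tau>) \<in> carrier (colored_perm_group n p). j \<le> n \<and>
     (\<forall>i\<in>{1..n}. n < \<tau> i + j \<longrightarrow> t i = 0) \<and>
     (\<forall>i\<in>{1..n}. \<forall>i'\<in>{1..n}. i < i' \<longrightarrow> n < \<tau> i + j \<longrightarrow> n < \<tau> i' + j \<longrightarrow> \<tau> i < \<tau> i')}"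

lemma tail_sorted_subset_carrier: "tail_sorted n p j \<subseteq> carrier (colored_perm_group n p)"
  by (auto simp: tail_sorted_def)

lemma tail_sorted_antimono: "i \<le> j \<Longrightarrow> tail_sorted n p j \<subseteq> tail_sorted n p i"
  unfolding tail_sorted_def
proof (intro subsetI, elim CollectE, intro CollectI, clarify, intro conjI ballI impI)
  fix t :: "nat \<Rightarrow> int" and \<tau> a b
  assume "i \<le> j"
    and *: "\<forall>a\<in>{1..n}. n < \<tau> a + j \<longrightarrow> t a = 0"
      "\<forall>a\<in>{1..n}. \<forall>b\<in>{1..n}. a < b \<longrightarrow> n < \<tau> a + j \<longrightarrow> n < \<tau> b + j \<longrightarrow> \<tau> a < \<tau> b"
  {
    assume "a \<in> {1..n}" "n < \<tau> a + i"
    moreover from this have "n < \<tau> a + j" using \<open>i \<le> j\<close> by simp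
    ultimately show "t a = 0" using *(1) by blast
  next
    assume "a \<in> {1..n}" "b \<in> {1..n}" "a < b" "n < \<tau> a + i" "n < \<tau> b + i"
    moreover from this have "n < \<tau> a + j" "n < \<tau> b + j" using \<open>i \<le> j\<close> by simp_all
    ultimately show "\<tau> a < \<tau> b" using *(2) by blast
  }
qed auto

lemma tail_sorted_0:
  assumes "p \<ge> 1"
  shows "tail_sorted n p 0 = carrier (colored_perm_group n p)"
proof -
  have "\<not> n < \<tau> i + 0" if "(t, \<tau>) \<in> carrier (colored_perm_group n p)" "i \<in> {1..n}"
    for t :: "nat \<Rightarrow> int" and \<tau> i
    using that assms permutes_in_image[of \<tau> "{1..n}" i] by (auto simp: carrier_colored_perm_group)
  then show ?thesis
    unfolding tail_sorted_def by blast
qed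

lemma tail_sorted_gt: "n < j \<Longrightarrow> tail_sorted n p j = {}"
  by (auto simp: tail_sorted_def)

section \<open>Effect of one insertion on the sorted tail\<close>

text \<open>One transition of the shuffle, from \<open>(t, \<tau>)\<close> to
  \<open>(s, \<rho>)\<close>. The letter on top before it is \<open>\<tau> 1\<close>, of color
  \<open>t 1\<close>; afterwards it stands at place \<open>m\<close>.\<close>

locale insertion_step =
  fixes n p m :: nat and c :: int and t :: "nat \<Rightarrow> int" and \<tau> :: "nat \<Rightarrow> nat"
    and s :: "nat \<Rightarrow> int" and \<rho> :: "nat \<Rightarrow> nat"
  assumes p: "p \<ge> 1" and m: "m \<in> {1..n}" and c: "c \<in> {0..<int p}"
    and y: "(t, \<tau>) \<in> carrier (colored_perm_group n p)"
    and x: "(s, \<rho>) = (t, \<tau>) \<otimes>\<^bsub>colored_perm_group n p\<^esub> insertion n m c"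
begin

definition \<sigma> :: "nat \<Rightarrow> nat" where "\<sigma> = snd (insertion n m c)"

lemma \<sigma>_permutes: "\<sigma> permutes {1..n}"
  using insertion_in_carrier[OF p m c] p by (simp add: \<sigma>_def carrier_colored_perm_group mem_Times_iff)

lemma \<sigma>_m [simp]: "\<sigma> m = 1"
  by (simp add: \<sigma>_def insertion_def)

lemma \<sigma>_less_iff: "a \<in> {1..n} \<Longrightarrow> b \<in> {1..n} \<Longrightarrow> a \<noteq> m \<Longrightarrow> b \<noteq> m \<Longrightarrow> \<sigma> a < \<sigma> b \<longleftrightarrow> a < b"
  by (auto simp: \<sigma>_def insertion_def)

lemma \<rho>_eq: "\<rho> = \<tau> \<circ> \<sigma>"
  using x by (simp add: colored_perm_group_def \<sigma>_def split_beta)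

lemma s_eq: "i \<in> {1..n} \<Longrightarrow> s i = (t (\<sigma> i) + (if i = m then c else 0)) mod int p"
  using x p by (simp add: colored_perm_group_def insertion_def \<sigma>_def)

lemma \<tau>_permutes: "\<tau> permutes {1..n}"
  using y p by (simp add: carrier_colored_perm_group)

lemma \<sigma>_in: "i \<in> {1..n} \<Longrightarrow> \<sigma> i \<in> {1..n}"
  using permutes_in_image[OF \<sigma>_permutes] by blast

lemma t_range: "i \<in> {1..n} \<Longrightarrow> t i \<in> {0..<int p}"
  using y p by (auto simp: carrier_colored_perm_group)

lemma s_eq_off: "i \<in> {1..n} \<Longrightarrow> i \<noteq> m \<Longrightarrow> s i = t (\<sigma> i)"
  using s_eq[of i] t_range[OF \<sigma>_in, of i] by simp

lemma \<rho>_m: "\<rho> m = \<tau> 1"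
  by (simp add: \<rho>_eq)

text \<open>The new color \<open>s m\<close> is \<open>t 1 + c\<close> modulo \<open>p\<close>.
  Hence, for a fixed result and a fixed place, exactly one choice of \<open>c\<close> comes from a
  top letter of color 0.\<close>

lemma top_color_0_iff: "t 1 = 0 \<longleftrightarrow> c = s m"
proof -
  have 1: "t 1 \<in> {0..<int p}" using t_range[of 1] m by auto
  have sm: "s m = (t 1 + c) mod int p" using s_eq[OF m] by simp
  show ?thesis
  proof
    assume "t 1 = 0" then show "c = s m" using sm c by simp
  next
    assume "c = s m"
    then have "(t 1 + c) mod int p = (0 + c) mod int p" using sm c by simp
    then have "t 1 mod int p = 0 mod int p" by (metis add_diff_cancel_right' mod_diff_left_eq)
    then show "t 1 = 0" using 1 by simp
  qed
qed

lemma x_carrier: "(s, \<rho>) \<in> carrier (colored_perm_group n p)"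
  unfolding x using insertion_in_carrier[OF p m c] y group_colored_perm_group
  by (intro monoid.m_closed group.is_monoid)

lemma ball_\<sigma>: "(\<forall>i\<in>{1..n}. P i) \<longleftrightarrow> (\<forall>i\<in>{1..n}. P (\<sigma> i))"
proof -
  have "(\<forall>i\<in>{1..n}. P i) \<longleftrightarrow> (\<forall>i\<in>\<sigma> ` {1..n}. P i)"
    by (simp only: permutes_image[OF \<sigma>_permutes])
  then show ?thesis by blast
qed

text \<open>The moved letter is not among the \<open>j\<close> largest, and the step keeps the
  colors and the relative order of all others.\<close>

lemma tail_sorted_iff_low:
  assumes "\<tau> 1 + j \<le> n"
  shows "(t, \<tau>) \<in> tail_sorted n p j \<longleftrightarrow> (s, \<rho>) \<in> tail_sorted n p j"
proof -
  have nm: "i \<noteq> m" if "n < \<tau> (\<sigma> i) + j" for i using that assms by auto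
  have "(\<forall>i\<in>{1..n}. n < \<tau> i + j \<longrightarrow> t i = 0) \<longleftrightarrow> (\<forall>i\<in>{1..n}. n < \<tau> (\<sigma> i) + j \<longrightarrow> t (\<sigma> i) = 0)"
    by (rule ball_\<sigma>)
  also have "\<dots> \<longleftrightarrow> (\<forall>i\<in>{1..n}. n < \<rho> i + j \<longrightarrow> s i = 0)"
    using nm s_eq_off by (auto simp: \<rho>_eq)
  finally have 1: "(\<forall>i\<in>{1..n}. n < \<tau> i + j \<longrightarrow> t i = 0) \<longleftrightarrow> (\<forall>i\<in>{1..n}. n < \<rho> i + j \<longrightarrow> s i = 0)" .
  have "(\<forall>i\<in>{1..n}. \<forall>i'\<in>{1..n}. i < i' \<longrightarrow> n < \<tau> i + j \<longrightarrow> n < \<tau> i' + j \<longrightarrow> \<tau> i < \<tau> i') \<longleftrightarrow>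
     (\<forall>i\<in>{1..n}. \<forall>i'\<in>{1..n}. \<sigma> i < \<sigma> i' \<longrightarrow> n < \<tau> (\<sigma> i) + j \<longrightarrow> n < \<tau> (\<sigma> i') + j \<longrightarrow> \<tau> (\<sigma> i) < \<tau> (\<sigma> i'))"
    by (subst ball_\<sigma>) (rule ball_cong[OF refl], rule ball_\<sigma>)
  also have "\<dots> \<longleftrightarrow> (\<forall>i\<in>{1..n}. \<forall>i'\<in>{1..n}. i < i' \<longrightarrow> n < \<rho> i + j \<longrightarrow> n < \<rho> i' + j \<longrightarrow> \<rho> i < \<rho> i')"
    unfolding \<rho>_eq o_def using nm \<sigma>_less_iff by blast
  finally show ?thesis using 1 y x_carrier by (simp add: tail_sorted_def)
qed

text \<open>The moved letter is the smallest of the \<open>j\<close> largest. On top it precedes the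
  others automatically, so \<open>D j\<close> demands only its color 0 beyond
  \<open>D (j - 1)\<close>; after the move its place and color are irrelevant to
  \<open>D (j - 1)\<close>.\<close>

lemma tail_sorted_iff_next:
  assumes "\<tau> 1 + j = n + 1" "j \<le> n"
  shows "(t, \<tau>) \<in> tail_sorted n p j \<longleftrightarrow> (s, \<rho>) \<in> tail_sorted n p (j - 1) \<and> c = s m"
proof -
  have "1 \<in> {1..n}" using m by auto
  then have "\<tau> 1 \<in> {1..n}" using permutes_in_image[OF \<tau>_permutes] by blast
  then have j: "j \<ge> 1" using assms by auto
  have iff: "n < \<tau> i + j \<longleftrightarrow> n < \<tau> i + (j - 1) \<or> i = 1" for i
  proof -
    have "n < \<tau> i + j \<longleftrightarrow> n < \<tau> i + (j - 1) \<or> \<tau> i = \<tau> 1" using assms j by auto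
    then show ?thesis using permutes_inj[OF \<tau>_permutes] by (simp add: inj_eq)
  qed
  have low: "\<tau> 1 < \<tau> i" if "n < \<tau> i + (j - 1)" for i using that assms j by auto
  have "(t, \<tau>) \<in> tail_sorted n p j \<longleftrightarrow> (t, \<tau>) \<in> tail_sorted n p (j - 1) \<and> t 1 = 0"
  proof
    assume *: "(t, \<tau>) \<in> tail_sorted n p j"
    then have "t 1 = 0" using \<open>1 \<in> {1..n}\<close> assms by (auto simp: tail_sorted_def)
    then show "(t, \<tau>) \<in> tail_sorted n p (j - 1) \<and> t 1 = 0"
      using * tail_sorted_antimono[of "j - 1" j] by auto
  next
    assume *: "(t, \<tau>) \<in> tail_sorted n p (j - 1) \<and> t 1 = 0"
    have "t i = 0" if "i \<in> {1..n}" "n < \<tau> i + j" for i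
      using * that unfolding tail_sorted_def iff by blast
    moreover have "\<tau> i < \<tau> i'" if "i \<in> {1..n}" "i' \<in> {1..n}" "i < i'" "n < \<tau> i + j" "n < \<tau> i' + j" for i i'
    proof -
      have "i' \<noteq> 1" using that by auto
      then have i': "n < \<tau> i' + (j - 1)" using that(5) unfolding iff by blast
      show ?thesis
      proof (cases "i = 1")
        case True
        then show ?thesis using low[OF i'] by simp
      next
        case False
        then have "n < \<tau> i + (j - 1)" using that(4) unfolding iff by blast
        then show ?thesis using * i' that unfolding tail_sorted_def by blast
      qed
    qed
    ultimately show "(t, \<tau>) \<in> tail_sorted n p j"
      using y assms(2) unfolding tail_sorted_def by blast
  qed
  also have "(t, \<tau>) \<in> tail_sorted n p (j - 1) \<longleftrightarrow> (s, \<rho>) \<in> tail_sorted n p (j - 1)"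
    using assms j by (intro tail_sorted_iff_low) auto
  finally show ?thesis by (simp only: top_color_0_iff)
qed

text \<open>A sorted tail would put the letter \<open>n + 1 - j\<close> before the larger letter on
  top, but nothing precedes position 1.\<close>

lemma tail_sorted_high:
  assumes "\<tau> 1 + j > n + 1"
  shows "(t, \<tau>) \<notin> tail_sorted n p j"
proof
  assume *: "(t, \<tau>) \<in> tail_sorted n p j"
  have 1: "1 \<in> {1..n}" using m by auto
  then have \<tau>1: "\<tau> 1 \<in> {1..n}" using permutes_in_image[OF \<tau>_permutes] by blast
  have "n + 1 - j \<in> {1..n}" using * assms \<tau>1 by (auto simp: tail_sorted_def)
  then obtain i where i: "i \<in> {1..n}" "\<tau> i = n + 1 - j"
    using permutes_image[OF \<tau>_permutes] by (metis imageE)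
  have "i \<noteq> 1" using i assms \<tau>1 by auto
  then have "1 < i" using i by auto
  moreover have "n < \<tau> i + j" "n < \<tau> 1 + j" using i assms by auto
  ultimately have "\<tau> 1 < \<tau> i" using * 1 i(1) by (auto simp: tail_sorted_def)
  then show False using i assms by simp
qed

end

text \<open>Counts the predecessors of \<open>x\<close> in \<open>D j\<close>. The letter
  \<open>v = \<rho> m\<close> at place \<open>m\<close> was on top before: each of the
  \<open>n - j\<close> small values of \<open>v\<close> admits all \<open>p\<close> colors, the
  value \<open>n + 1 - j\<close> admits one, larger values admit none.\<close>

lemma sum_insertion_tail_sorted:
  fixes n p
  defines "G \<equiv> colored_perm_group n p"
  assumes "p \<ge> 1" "j \<le> n" and x: "x \<in> carrier G"
  shows "(\<Sum>m\<in>{1..n}. \<Sum>c\<in>{0..<int p}. of_bool (x \<otimes>\<^bsub>G\<^esub> inv\<^bsub>G\<^esub> insertion n m c \<in> tail_sorted n p j)) =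
    real ((n - j) * p) * of_bool (x \<in> tail_sorted n p j)
    + (if j = 0 then 0 else of_bool (x \<in> tail_sorted n p (j - 1)))"
proof -
  interpret G: group G unfolding G_def by (rule group_colored_perm_group)
  obtain s \<rho> where x_eq: "x = (s, \<rho>)" by (cases x)
  have \<rho>: "\<rho> permutes {1..n}" using x assms(2) by (simp add: x_eq G_def carrier_colored_perm_group)
  have s: "s i \<in> {0..<int p}" if "i \<in> {1..n}" for i
    using x assms(2) that by (auto simp: x_eq G_def carrier_colored_perm_group)
  let ?g = "\<lambda>v. if v + j \<le> n then real p * of_bool (x \<in> tail_sorted n p j)
      else if v + j = n + 1 then of_bool (x \<in> tail_sorted n p (j - 1)) else 0"
  have "(\<Sum>c\<in>{0..<int p}. of_bool (x \<otimes>\<^bsub>G\<^esub> inv\<^bsub>G\<^esub> insertion n m c \<in> tail_sorted n p j)) = ?g (\<rho> m)"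
    if m: "m \<in> {1..n}" for m
  proof -
    have step: "\<exists>t \<tau>. x \<otimes>\<^bsub>G\<^esub> inv\<^bsub>G\<^esub> insertion n m c = (t, \<tau>) \<and> insertion_step n p m c t \<tau> s \<rho>"
      if c: "c \<in> {0..<int p}" for c
    proof -
      have ins: "insertion n m c \<in> carrier G"
        unfolding G_def using assms(2) m c by (rule insertion_in_carrier)
      obtain t \<tau> where y: "x \<otimes>\<^bsub>G\<^esub> inv\<^bsub>G\<^esub> insertion n m c = (t, \<tau>)"
        by (cases "x \<otimes>\<^bsub>G\<^esub> inv\<^bsub>G\<^esub> insertion n m c")
      have "(t, \<tau>) \<in> carrier G" unfolding y[symmetric] using ins x by simp
      moreover have "(t, \<tau>) \<otimes>\<^bsub>G\<^esub> insertion n m c = x"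
        unfolding y[symmetric] using ins x by (simp add: G.m_assoc)
      ultimately have "insertion_step n p m c t \<tau> s \<rho>"
        using assms(2) m c by (unfold_locales) (simp_all add: x_eq G_def)
      with y show ?thesis by blast
    qed
    consider "\<rho> m + j \<le> n" | "\<rho> m + j = n + 1" | "\<rho> m + j > n + 1" by linarith
    then show ?thesis
    proof cases
      case 1
      have "x \<otimes>\<^bsub>G\<^esub> inv\<^bsub>G\<^esub> insertion n m c \<in> tail_sorted n p j \<longleftrightarrow> x \<in> tail_sorted n p j"
        if "c \<in> {0..<int p}" for c
        using step[OF that] 1 insertion_step.tail_sorted_iff_low insertion_step.\<rho>_m x_eq by metis
      then show ?thesis using 1 by simp
    next
      case 2
      have "x \<otimes>\<^bsub>G\<^esub> inv\<^bsub>G\<^esub> insertion n m c \<in> tail_sorted n p j \<longleftrightarrow> x \<in> tail_sorted n p (j - 1) \<and> c = s m"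
        if "c \<in> {0..<int p}" for c
        using step[OF that] 2 insertion_step.tail_sorted_iff_next[OF _ _ assms(3)] insertion_step.\<rho>_m x_eq by metis
      then have "(\<Sum>c\<in>{0..<int p}. of_bool (x \<otimes>\<^bsub>G\<^esub> inv\<^bsub>G\<^esub> insertion n m c \<in> tail_sorted n p j)) =
          (\<Sum>c\<in>{0..<int p}. if c = s m then of_bool (x \<in> tail_sorted n p (j - 1)) else (0::real))"
        by (intro sum.cong refl) auto
      also have "\<dots> = of_bool (x \<in> tail_sorted n p (j - 1))"
        using s[OF m] by simp
      finally show ?thesis using 2 by simp
    next
      case 3
      have "x \<otimes>\<^bsub>G\<^esub> inv\<^bsub>G\<^esub> insertion n m c \<notin> tail_sorted n p j" if "c \<in> {0..<int p}" for c
        using step[OF that] 3 insertion_step.tail_sorted_high insertion_step.\<rho>_m by metis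
      then show ?thesis using 3 by simp
    qed
  qed
  then have "(\<Sum>m\<in>{1..n}. \<Sum>c\<in>{0..<int p}. of_bool (x \<otimes>\<^bsub>G\<^esub> inv\<^bsub>G\<^esub> insertion n m c \<in> tail_sorted n p j))
      = (\<Sum>m\<in>{1..n}. ?g (\<rho> m))" by simp
  also have "\<dots> = (\<Sum>v\<in>{1..n}. ?g v)"
    by (rule sum.reindex_bij_betw[OF permutes_imp_bij[OF \<rho>]])
  \<comment> \<open>For \<open>j = 0\<close> the value \<open>n + 1 - j\<close> falls outside the
    range, which is the source of the case distinction in the claim.\<close>
  also have "\<dots> = (\<Sum>v\<in>{1..n}. if v \<in> {1..n - j} then real p * of_bool (x \<in> tail_sorted n p j) else 0)
      + (\<Sum>v\<in>{1..n}. if v = n + 1 - j then of_bool (x \<in> tail_sorted n p (j - 1)) else 0)"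
    unfolding sum.distrib[symmetric] using assms(3) by (intro sum.cong refl) auto
  also have "(\<Sum>v\<in>{1..n}. if v \<in> {1..n - j} then real p * of_bool (x \<in> tail_sorted n p j) else 0)
      = (\<Sum>v\<in>{1..n - j}. real p * of_bool (x \<in> tail_sorted n p j))"
    by (intro sum.mono_neutral_cong_right) auto
  finally show ?thesis using assms(3) by (auto simp: mult_ac)
qed

text \<open>Summing the preceding identity over the group yields \<open>|D (j - 1)| = j p |D j|\<close>, because right
  translations are bijections.\<close>

lemma card_tail_sorted:
  assumes "p \<ge> 1" "n \<ge> 1" "j \<le> n"
  shows "real (card (tail_sorted n p j)) * (fact j * real p ^ j) = fact n * real p ^ n"
  using assms(3)
proof (induction j)
  case 0
  then show ?case using card_colored_perm_group[OF assms(1), of n] by (simp add: tail_sorted_0[OF assms(1)])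
next
  case (Suc j)
  define G where "G = colored_perm_group n p"
  interpret G: group G unfolding G_def by (rule group_colored_perm_group)
  have fin: "finite (carrier G)" unfolding G_def by (rule finite_colored_perm_group[OF assms(1)])
  have card: "(\<Sum>x\<in>carrier G. of_bool (x \<in> tail_sorted n p i)) = real (card (tail_sorted n p i))" for i
    using fin tail_sorted_subset_carrier[of n p i] unfolding G_def[symmetric]
    by (simp add: of_bool_def sum.If_cases Int_absorb1)
  have tr: "(\<Sum>x\<in>carrier G. of_bool (x \<otimes>\<^bsub>G\<^esub> inv\<^bsub>G\<^esub> b \<in> tail_sorted n p i)) = real (card (tail_sorted n p i))"
    if b: "b \<in> carrier G" for b i
    unfolding card[symmetric] using b
    by (intro sum.reindex_bij_witness[where i = "\<lambda>x. x \<otimes>\<^bsub>G\<^esub> b" and j = "\<lambda>x. x \<otimes>\<^bsub>G\<^esub> inv\<^bsub>G\<^esub> b"])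
      (auto simp: G.m_assoc)
  have "(\<Sum>x\<in>carrier G. \<Sum>m\<in>{1..n}. \<Sum>c\<in>{0..<int p}.
      of_bool (x \<otimes>\<^bsub>G\<^esub> inv\<^bsub>G\<^esub> insertion n m c \<in> tail_sorted n p (Suc j)))
    = (\<Sum>m\<in>{1..n}. \<Sum>c\<in>{0..<int p}. \<Sum>x\<in>carrier G.
      of_bool (x \<otimes>\<^bsub>G\<^esub> inv\<^bsub>G\<^esub> insertion n m c \<in> tail_sorted n p (Suc j)))"
    by (subst sum.swap) (rule sum.cong[OF refl], rule sum.swap)
  also have "\<dots> = (\<Sum>m\<in>{1..n}. \<Sum>c\<in>{0..<int p}. real (card (tail_sorted n p (Suc j))))"
    by (intro sum.cong refl tr) (use insertion_in_carrier[OF assms(1)] in \<open>auto simp: G_def\<close>)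
  also have "\<dots> = real n * real p * real (card (tail_sorted n p (Suc j)))" by simp
  also have "(\<Sum>x\<in>carrier G. \<Sum>m\<in>{1..n}. \<Sum>c\<in>{0..<int p}.
      of_bool (x \<otimes>\<^bsub>G\<^esub> inv\<^bsub>G\<^esub> insertion n m c \<in> tail_sorted n p (Suc j)))
    = (\<Sum>x\<in>carrier G. real ((n - Suc j) * p) * of_bool (x \<in> tail_sorted n p (Suc j))
      + of_bool (x \<in> tail_sorted n p j))"
    unfolding G_def
    by (intro sum.cong refl, subst sum_insertion_tail_sorted) (use assms(1) Suc.prems in auto)
  also have "\<dots> = real ((n - Suc j) * p) * real (card (tail_sorted n p (Suc j))) + real (card (tail_sorted n p j))"
    by (simp only: sum.distrib card flip: sum_distrib_left)
  also have "real ((n - Suc j) * p) = (real n - real (Suc j)) * real p"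
    using Suc.prems by (simp add: of_nat_diff)
  finally have "real (card (tail_sorted n p j)) = real (Suc j) * real p * real (card (tail_sorted n p (Suc j)))"
    by (simp add: algebra_simps)
  then show ?case using Suc by (simp add: mult_ac)
qed

lemma card_tail_sorted_eq:
  assumes "p \<ge> 1" "n \<ge> 1" "j \<le> n"
  shows "real (card (tail_sorted n p j)) = fact n * real p ^ n / (fact j * real p ^ j)"
  using card_tail_sorted[OF assms] assms(1) by (simp add: field_simps)

text \<open>The identity belongs to the set, and the cardinality formula leaves room for one element
  only.\<close>

lemma tail_sorted_full:
  assumes "p \<ge> 1" "n \<ge> 1"
  shows "tail_sorted n p n = {\<one>\<^bsub>colored_perm_group n p\<^esub>}"
proof -
  have "\<one>\<^bsub>colored_perm_group n p\<^esub> \<in> carrier (colored_perm_group n p)"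
    by (intro monoid.one_closed group.is_monoid group_colored_perm_group)
  then have "\<one>\<^bsub>colored_perm_group n p\<^esub> \<in> tail_sorted n p n"
    by (auto simp: tail_sorted_def) (auto simp: colored_perm_group_def)
  moreover have "card (tail_sorted n p n) = 1"
    using card_tail_sorted_eq[OF assms order.refl] assms by simp
  moreover from this obtain z where "tail_sorted n p n = {z}" by (elim card_1_singletonE)
  ultimately show ?thesis by simp
qed

section \<open>The law after \<open>k\<close> shuffles as a mixture of uniform distributions\<close>

text \<open>The right side mixes the uniform distributions on the sets \<open>D j\<close> with
  weights \<open>empty_prob n k j\<close>. Initially all mass is on \<open>D n\<close>, the
  identity. By the count of predecessors, a step keeps the uniform distribution on
  \<open>D j\<close> with weight \<open>1 - j / n\<close> and replaces it by that on
  \<open>D (j - 1)\<close> with weight \<open>j / n\<close>, exactly as a ball acts on empty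
  boxes.\<close>

lemma shuffle_power:
  fixes n p
  defines "G \<equiv> colored_perm_group n p"
  assumes "p \<ge> 1" "n \<ge> 1"
  shows "(top_to_random n p [^]\<^bsub>group_algebra G\<^esub> k) x =
    (\<Sum>j\<le>n. empty_prob n k j * (fact j * real p ^ j * of_bool (x \<in> tail_sorted n p j))) / (fact n * real p ^ n)"
proof (induction k arbitrary: x)
  case 0
  have "(top_to_random n p [^]\<^bsub>group_algebra G\<^esub> (0::nat)) x = of_bool (x \<in> tail_sorted n p n)"
    using tail_sorted_full[OF assms(2,3)] by (simp add: group_algebra_def G_def)
  then show ?case
    using assms by (simp add: empty_prob_0 if_distrib[of "\<lambda>x. x * _"] cong: if_cong)
next
  case (Suc k)
  let ?w = "\<lambda>j. fact j * real p ^ j" and ?N = "fact n * real p ^ n"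
  let ?f = "top_to_random n p [^]\<^bsub>group_algebra G\<^esub> k"
  have outside: "x \<notin> tail_sorted n p j" if "x \<notin> carrier G" for x j
    using that tail_sorted_subset_carrier[of n p j] unfolding G_def by blast
  have f0: "?f x = 0" if "x \<notin> carrier G" for x
    unfolding Suc.IH using outside[OF that] by simp
  have pow: "top_to_random n p [^]\<^bsub>group_algebra G\<^esub> Suc k = ?f \<otimes>\<^bsub>group_algebra G\<^esub> top_to_random n p"
    by (simp add: nat_pow_def)
  show ?case
  proof (cases "x \<in> carrier G")
    case True
    have "(?f \<otimes>\<^bsub>group_algebra G\<^esub> top_to_random n p) x =
        (\<Sum>m\<in>{1..n}. \<Sum>c\<in>{0..<int p}. ?f (x \<otimes>\<^bsub>G\<^esub> inv\<^bsub>G\<^esub> insertion n m c)) / real (n * p)"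
      using mult_top_to_random[OF assms(2,3), of ?f x] f0 True unfolding G_def by blast
    also have "\<dots> = (\<Sum>m\<in>{1..n}. \<Sum>c\<in>{0..<int p}. \<Sum>j\<le>n. empty_prob n k j * ?w j / (?N * real (n * p)) *
        of_bool (x \<otimes>\<^bsub>G\<^esub> inv\<^bsub>G\<^esub> insertion n m c \<in> tail_sorted n p j))"
      unfolding Suc.IH sum_divide_distrib by (intro sum.cong refl) simp
    also have "\<dots> = (\<Sum>m\<in>{1..n}. \<Sum>j\<le>n. \<Sum>c\<in>{0..<int p}. empty_prob n k j * ?w j / (?N * real (n * p)) *
        of_bool (x \<otimes>\<^bsub>G\<^esub> inv\<^bsub>G\<^esub> insertion n m c \<in> tail_sorted n p j))"
      by (rule sum.cong[OF refl], rule sum.swap)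
    also have "\<dots> = (\<Sum>j\<le>n. \<Sum>m\<in>{1..n}. \<Sum>c\<in>{0..<int p}. empty_prob n k j * ?w j / (?N * real (n * p)) *
        of_bool (x \<otimes>\<^bsub>G\<^esub> inv\<^bsub>G\<^esub> insertion n m c \<in> tail_sorted n p j))"
      by (rule sum.swap)
    also have "\<dots> = (\<Sum>j\<le>n. empty_prob n k j * ?w j / (?N * real (n * p)) *
        (real ((n - j) * p) * of_bool (x \<in> tail_sorted n p j)
         + (if j = 0 then 0 else of_bool (x \<in> tail_sorted n p (j - 1)))))"
    proof (intro sum.cong refl)
      fix j assume "j \<in> {..n}"
      then have j: "j \<le> n" by simp
      show "(\<Sum>m\<in>{1..n}. \<Sum>c\<in>{0..<int p}. empty_prob n k j * ?w j / (?N * real (n * p)) *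
          of_bool (x \<otimes>\<^bsub>G\<^esub> inv\<^bsub>G\<^esub> insertion n m c \<in> tail_sorted n p j)) =
        empty_prob n k j * ?w j / (?N * real (n * p)) *
        (real ((n - j) * p) * of_bool (x \<in> tail_sorted n p j)
         + (if j = 0 then 0 else of_bool (x \<in> tail_sorted n p (j - 1))))"
        unfolding sum_insertion_tail_sorted[OF assms(2) j True[unfolded G_def], symmetric] G_def
        by (simp only: sum_distrib_left)
    qed
    also have "\<dots> = (\<Sum>j\<le>n. empty_prob n k j *
        ((1 - real j / real n) * (?w j * of_bool (x \<in> tail_sorted n p j))
          + real j / real n * (?w (j - 1) * of_bool (x \<in> tail_sorted n p (j - 1)))) / ?N)"
    proof (intro sum.cong refl)
      fix j assume "j \<in> {..n}"
      then have nj: "real ((n - j) * p) = (real n - real j) * real p" by (simp add: of_nat_diff)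
      have pos: "real n > 0" "real p > 0" using assms by auto
      \<comment> \<open>For positive \<open>j\<close>, \<open>?w j = j p ?w (j - 1)\<close> turns
        the factor \<open>1 / (n p)\<close> into \<open>j / n\<close>; for \<open>j = 0\<close> both
        second summands vanish.\<close>
      show "empty_prob n k j * ?w j / (?N * real (n * p)) *
          (real ((n - j) * p) * of_bool (x \<in> tail_sorted n p j)
           + (if j = 0 then 0 else of_bool (x \<in> tail_sorted n p (j - 1)))) =
        empty_prob n k j *
        ((1 - real j / real n) * (?w j * of_bool (x \<in> tail_sorted n p j))
          + real j / real n * (?w (j - 1) * of_bool (x \<in> tail_sorted n p (j - 1)))) / ?N"
        unfolding nj using pos by (cases j) (auto simp: field_simps)
    qed
    also have "\<dots> = (\<Sum>j\<le>n. empty_prob n k j *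
        ((1 - real j / real n) * (?w j * of_bool (x \<in> tail_sorted n p j))
          + real j / real n * (?w (j - 1) * of_bool (x \<in> tail_sorted n p (j - 1))))) / ?N"
      by (simp only: sum_divide_distrib)
    also have "\<dots> = (\<Sum>j\<le>n. empty_prob n (Suc k) j * (?w j * of_bool (x \<in> tail_sorted n p j))) / ?N"
      by (subst sum_empty_prob_Suc[OF assms(3)]) (rule refl)
    finally show ?thesis unfolding pow .
  next
    case False
    have h0: "top_to_random n p b = 0" if "b \<notin> carrier G" for b
      using that by (simp add: top_to_random_def group_algebra_def B1_def word_sum_def G_def)
    have "(?f \<otimes>\<^bsub>group_algebra G\<^esub> top_to_random n p) x = 0"
      by (rule group_algebra_mult_outside[OF _ f0 h0 False]) (simp add: G_def group_colored_perm_group)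
    then show ?thesis
      unfolding pow using outside[OF False] by simp
  qed
qed

section \<open>Total variation distance\<close>

text \<open>The limiting proportion of words whose maximal sorted tail has length exactly \<open>j\<close>.\<close>

definition tail_weight :: "nat \<Rightarrow> nat \<Rightarrow> real" where
  "tail_weight p j = 1 / (fact j * real p ^ j) - 1 / (fact (Suc j) * real p ^ Suc j)"

lemma sum_tail_weight: "(\<Sum>j<m. tail_weight p j) = 1 - 1 / (fact m * real p ^ m)"
  unfolding tail_weight_def by (subst sum_lessThan_telescope') simp

lemma tail_weight_nonneg:
  assumes "p \<ge> 1"
  shows "tail_weight p j \<ge> 0"
proof -
  have "fact j * real p ^ j \<le> fact (Suc j) * real p ^ Suc j"
    using assms by (intro mult_mono fact_mono power_increasing) (auto intro: fact_mono)
  then show ?thesis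
    using assms by (simp add: tail_weight_def frac_le)
qed

lemma tail_weight_sums:
  assumes "p \<ge> 1"
  shows "tail_weight p sums 1"
proof -
  have "(\<lambda>m. 1 / (fact m * real p ^ m)) \<longlonglongrightarrow> 0"
  proof (rule tendsto_sandwich[OF _ _ tendsto_const])
    show "(\<lambda>m. 1 / fact m :: real) \<longlonglongrightarrow> 0"
      using summable_LIMSEQ_zero[OF summable_exp[of "1::real"]] by (simp add: inverse_eq_divide)
    show "\<forall>\<^sub>F m in sequentially. 1 / (fact m * real p ^ m) \<le> 1 / fact m"
      using assms by (intro always_eventually allI frac_le) (auto simp: one_le_power)
  qed simp
  then have "(\<lambda>m. 1 - 1 / (fact m * real p ^ m)) \<longlonglongrightarrow> 1 - 0" by (intro tendsto_intros)
  then show ?thesis unfolding sums_def by (simp add: sum_tail_weight)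
qed

locale shuffle =
  fixes n p :: nat
  assumes p: "p \<ge> 1" and n: "n \<ge> 1"
begin

abbreviation "G \<equiv> colored_perm_group n p"
abbreviation "N \<equiv> fact n * real p ^ n"
abbreviation "D \<equiv> tail_sorted n p"
abbreviation "law \<equiv> \<lambda>k::nat. top_to_random n p [^]\<^bsub>group_algebra G\<^esub> k"

lemma N_pos: "N > 0"
  using p by simp

lemma fin: "finite (carrier G)"
  using p by (rule finite_colored_perm_group)

lemma finite_D: "finite (D j)"
  using fin tail_sorted_subset_carrier by (rule rev_finite_subset)

lemma sum_of_bool_D: "A \<subseteq> carrier G \<Longrightarrow> (\<Sum>x\<in>A. of_bool (x \<in> D j) :: real) = real (card (A \<inter> D j))"
  using fin by (simp add: of_bool_def sum.If_cases finite_subset)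

lemma card_D: "j \<le> n \<Longrightarrow> real (card (D j)) = N / (fact j * real p ^ j)"
  by (rule card_tail_sorted_eq[OF p n])

lemma sum_law:
  assumes "A \<subseteq> carrier G"
  shows "(\<Sum>x\<in>A. law k x) = (\<Sum>j\<le>n. empty_prob n k j * (real (card (A \<inter> D j)) / real (card (D j))))"
proof -
  have "(\<Sum>x\<in>A. law k x) = (\<Sum>x\<in>A. \<Sum>j\<le>n. empty_prob n k j * (fact j * real p ^ j) / N * of_bool (x \<in> D j))"
    unfolding shuffle_power[OF p n] sum_divide_distrib by (intro sum.cong refl) simp
  also have "\<dots> = (\<Sum>j\<le>n. \<Sum>x\<in>A. empty_prob n k j * (fact j * real p ^ j) / N * of_bool (x \<in> D j))"
    by (rule sum.swap)
  also have "\<dots> = (\<Sum>j\<le>n. empty_prob n k j * (fact j * real p ^ j) / N * real (card (A \<inter> D j)))"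
    unfolding sum_distrib_left[symmetric] sum_of_bool_D[OF assms] by (rule refl)
  also have "\<dots> = (\<Sum>j\<le>n. empty_prob n k j * (real (card (A \<inter> D j)) / real (card (D j))))"
    using p by (intro sum.cong refl) (simp add: card_D field_simps)
  finally show ?thesis .
qed

lemma sum_law_carrier: "(\<Sum>x\<in>carrier G. law k x) = 1"
proof -
  have "real (card (carrier G \<inter> D j)) / real (card (D j)) = 1" if "j \<in> {..n}" for j
    using tail_sorted_subset_carrier[of n p j] N_pos card_D[of j] that p by (simp add: Int_absorb1)
  then have "(\<Sum>x\<in>carrier G. law k x) = (\<Sum>j\<le>n. empty_prob n k j * 1)"
    unfolding sum_law[OF order.refl] by (intro sum.cong refl arg_cong2[where f = "(*)"])
  then show ?thesis using sum_empty_prob[OF n, of k] by simp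
qed

text \<open>Both distributions have total mass 1, so the positive and the negative part of their
  difference have equal sums.\<close>

lemma tv_eq_sum_pos: "tv_after_shuffles n p k = (\<Sum>x\<in>carrier G. max 0 (1 / N - law k x))"
proof -
  have card: "real (card (carrier G)) = N"
    using card_colored_perm_group[OF p, of n] by simp
  have "(\<Sum>x\<in>carrier G. \<bar>law k x - uniform_dist n p x\<bar>)
      = (\<Sum>x\<in>carrier G. 2 * max 0 (1 / N - law k x) + (law k x - 1 / N))"
    by (intro sum.cong refl) (auto simp: uniform_dist_def mult.commute max_def)
  also have "\<dots> = 2 * (\<Sum>x\<in>carrier G. max 0 (1 / N - law k x)) + (1 - 1)"
    using p by (simp add: sum.distrib sum_subtractf sum_law_carrier card sum_distrib_left)
  finally show ?thesis by (simp add: tv_after_shuffles_def d_TV_def)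
qed

text \<open>The test event is the complement of \<open>D J\<close>. Components with
  \<open>j \<ge> J\<close> give it no mass, because then \<open>D j\<close> lies in
  \<open>D J\<close>.\<close>

lemma tv_ge:
  assumes "J \<le> n"
  shows "tv_after_shuffles n p k \<ge> 1 - 1 / (fact J * real p ^ J) - (\<Sum>j<J. empty_prob n k j)"
proof -
  let ?A = "carrier G - D J"
  have DJ: "D J \<subseteq> carrier G" by (rule tail_sorted_subset_carrier)
  have "(\<Sum>j\<le>n. empty_prob n k j * (real (card (?A \<inter> D j)) / real (card (D j))))
      \<le> (\<Sum>j\<le>n. if j < J then empty_prob n k j else 0)"
  proof (intro sum_mono)
    fix j
    have le: "real (card (?A \<inter> D j)) / real (card (D j)) \<le> 1"
      using finite_D by (intro divide_le_eq_1[THEN iffD2]) (auto intro!: card_mono simp: card_gt_0_iff)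
    have "?A \<inter> D j = {}" if "\<not> j < J"
      using tail_sorted_antimono[of J j n p] that by auto
    then show "empty_prob n k j * (real (card (?A \<inter> D j)) / real (card (D j)))
        \<le> (if j < J then empty_prob n k j else 0)"
      using mult_left_mono[OF le empty_prob_nonneg[OF n, of k j]] by simp
  qed
  also have "\<dots> = (\<Sum>j<J. empty_prob n k j)"
    using assms by (intro sum.mono_neutral_cong_right) auto
  finally have 1: "(\<Sum>x\<in>?A. law k x) \<le> (\<Sum>j<J. empty_prob n k j)"
    by (simp add: sum_law)
  have "real (card ?A) = real (card (carrier G)) - real (card (D J))"
    by (simp add: card_Diff_subset[OF finite_D DJ] of_nat_diff[OF card_mono[OF fin DJ]])
  then have "real (card ?A) = N - N / (fact J * real p ^ J)"
    using card_D[OF assms] card_colored_perm_group[OF p, of n] by simp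
  then have 2: "(\<Sum>x\<in>?A. 1 / N) = 1 - 1 / (fact J * real p ^ J)"
    using p by (simp add: field_simps)
  have "(\<Sum>x\<in>?A. 1 / N - law k x) \<le> (\<Sum>x\<in>?A. max 0 (1 / N - law k x))"
    by (intro sum_mono) auto
  also have "\<dots> \<le> tv_after_shuffles n p k"
    unfolding tv_eq_sum_pos using fin by (intro sum_mono2) auto
  finally show ?thesis using 1 2 by (simp add: sum_subtractf)
qed

text \<open>The chain decreases from the whole group \<open>D 0\<close> to the empty set
  \<open>D (Suc n)\<close>, so its layers partition the group.\<close>

lemma sum_carrier_strata:
  fixes \<phi> :: "_ \<Rightarrow> real"
  shows "(\<Sum>x\<in>carrier G. \<phi> x) = (\<Sum>j\<le>n. \<Sum>x\<in>D j - D (Suc j). \<phi> x)"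
proof -
  have "(\<Sum>x\<in>D 0 - D m. \<phi> x) = (\<Sum>j<m. \<Sum>x\<in>D j - D (Suc j). \<phi> x)" for m
  proof (induction m)
    case (Suc m)
    have "D 0 - D (Suc m) = (D 0 - D m) \<union> (D m - D (Suc m))"
      using tail_sorted_antimono[of 0 m n p] tail_sorted_antimono[of m "Suc m" n p] by auto
    then have "(\<Sum>x\<in>D 0 - D (Suc m). \<phi> x) = (\<Sum>x\<in>D 0 - D m. \<phi> x) + (\<Sum>x\<in>D m - D (Suc m). \<phi> x)"
      using finite_D by (simp only:) (intro sum.union_disjoint, auto)
    then show ?case using Suc by simp
  qed simp
  from this[of "Suc n"] show ?thesis
    by (simp add: tail_sorted_gt tail_sorted_0[OF p] lessThan_Suc_atMost)
qed

text \<open>The law is constant on each layer \<open>D j - D (Suc j)\<close>, where only the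
  components \<open>i \<le> j\<close> contribute. The last layer stands apart: it is the identity
  alone, since \<open>D (Suc n)\<close> is empty, and its proportion is \<open>1 / N\<close> instead
  of \<open>tail_weight p n\<close>.\<close>

lemma tv_eq:
  "tv_after_shuffles n p k =
     (\<Sum>j<n. tail_weight p j * max 0 (1 - (\<Sum>i\<le>j. empty_prob n k i * (fact i * real p ^ i))))
     + max 0 (1 - (\<Sum>i\<le>n. empty_prob n k i * (fact i * real p ^ i))) / N"
proof -
  let ?R = "\<lambda>j. \<Sum>i\<le>j. empty_prob n k i * (fact i * real p ^ i)"
  have strat: "(\<Sum>x\<in>D j - D (Suc j). max 0 (1 / N - law k x)) =
      real (card (D j - D (Suc j))) * (max 0 (1 - ?R j) / N)" if "j \<le> n" for j
  proof -
    have "law k x = ?R j / N" if x: "x \<in> D j - D (Suc j)" for x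
    proof -
      have "x \<in> D i \<longleftrightarrow> i \<le> j" for i
        using x tail_sorted_antimono[of i j n p] tail_sorted_antimono[of "Suc j" i n p]
        by (cases "i \<le> j") auto
      then have "law k x = (\<Sum>i\<le>n. if i \<le> j then empty_prob n k i * (fact i * real p ^ i) else 0) / N"
        unfolding shuffle_power[OF p n] by (intro arg_cong2[where f = "(/)"] sum.cong refl) auto
      also have "(\<Sum>i\<le>n. if i \<le> j then empty_prob n k i * (fact i * real p ^ i) else 0) = ?R j"
        using \<open>j \<le> n\<close> by (intro sum.mono_neutral_cong_right) auto
      finally show ?thesis .
    qed
    then have "max 0 (1 / N - law k x) = max 0 (1 - ?R j) / N" if "x \<in> D j - D (Suc j)" for x
      using that p by (auto simp: max_def field_simps)
    then show ?thesis by simp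
  qed
  have card: "real (card (D j - D (Suc j))) = N * tail_weight p j" if "j < n" for j
    using that card_D[of j] card_D[of "Suc j"] finite_D tail_sorted_antimono[of j "Suc j" n p]
    by (simp add: card_Diff_subset of_nat_diff card_mono tail_weight_def right_diff_distrib)
  have cardn: "card (D n - D (Suc n)) = 1"
    using tail_sorted_full[OF p n] by (simp add: tail_sorted_gt)
  have "tv_after_shuffles n p k = (\<Sum>j\<le>n. real (card (D j - D (Suc j))) * (max 0 (1 - ?R j) / N))"
    unfolding tv_eq_sum_pos sum_carrier_strata by (intro sum.cong refl) (rule strat, simp)
  also have "\<dots> = (\<Sum>j<n. real (card (D j - D (Suc j))) * (max 0 (1 - ?R j) / N)) + max 0 (1 - ?R n) / N"
    by (simp only: lessThan_Suc_atMost[symmetric] sum.lessThan_Suc cardn)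
  also have "(\<Sum>j<n. real (card (D j - D (Suc j))) * (max 0 (1 - ?R j) / N)) = (\<Sum>j<n. tail_weight p j * max 0 (1 - ?R j))"
    using p by (intro sum.cong refl) (simp add: card)
  finally show ?thesis .
qed

end

section \<open>Limit at the cutoff\<close>

text \<open>The inclusion-exclusion terms converge to those of the alternating series of the Poisson
  probability, and Tannery's theorem exchanges limit and sum.\<close>

lemma empty_prob_tendsto_Poisson:
  fixes c :: real and k :: "nat \<Rightarrow> nat"
  assumes k: "\<And>n. k n = nat \<lfloor>real n * ln (real n) + c * real n\<rfloor>"
  shows "(\<lambda>n. empty_prob n (k n) j) \<longlonglongrightarrow> exp (- exp (- c)) * exp (- c) ^ j / fact j"
proof -
  define \<mu> where "\<mu> = exp (- c)"
  \<comment> \<open>Extended by 0 beyond \<open>r = n\<close>, so that the sum becomes a series with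
    index range independent of \<open>n\<close>.\<close>
  define a where "a = (\<lambda>r n. if r \<le> n then (-1) ^ (r + j) * real (r choose j) *
      (real (n choose r) * (1 - real r / real n) ^ k n) else 0)"
  define b where "b = (\<lambda>r. (-1) ^ (r + j) * real (r choose j) * (\<mu> ^ r / fact r))"
  \<comment> \<open>The dominating sequence: \<open>2 ^ r\<close> bounds \<open>r choose j\<close>,
    and the other factor comes from \<open>choose_times_power_le\<close>.\<close>
  define M where "M = (\<lambda>r. 2 ^ r * (exp ((1 - c) * real r) / fact r))"
  have lim: "(\<lambda>n. a r n) \<longlonglongrightarrow> b r" for r
  proof (rule Lim_transform_eventually)
    show "(\<lambda>n. (-1) ^ (r + j) * real (r choose j) * (real (n choose r) * (1 - real r / real n) ^ k n)) \<longlonglongrightarrow> b r"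
      unfolding b_def \<mu>_def by (intro tendsto_intros choose_times_power_tendsto k)
    show "\<forall>\<^sub>F n in sequentially. (-1) ^ (r + j) * real (r choose j) * (real (n choose r) * (1 - real r / real n) ^ k n) = a r n"
      using eventually_ge_at_top[of r] by eventually_elim (simp add: a_def)
  qed
  have bound: "norm (a r n) \<le> M r" if "n \<ge> 1" for r n
  proof (cases "r \<le> n")
    case True
    have "real n * ln (real n) + c * real n - 1 \<le> real (k n)" unfolding k by linarith
    then have 1: "real (n choose r) * (1 - real r / real n) ^ k n \<le> exp ((1 - c) * real r) / fact r"
      using that True by (intro choose_times_power_le)
    have 2: "real (r choose j) \<le> 2 ^ r"
      using binomial_le_pow2[of r j] by (metis of_nat_le_iff of_nat_numeral of_nat_power)
    have 3: "0 \<le> (1 - real r / real n) ^ k n" using True by (auto intro!: zero_le_power simp: divide_le_eq)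
    have "norm (a r n) = real (r choose j) * (real (n choose r) * (1 - real r / real n) ^ k n)"
      using True abs_of_nonneg[OF 3] by (simp add: a_def abs_mult)
    also have "\<dots> \<le> M r" unfolding M_def using 3 by (intro mult_mono 1 2) auto
    finally show ?thesis .
  qed (simp add: a_def M_def)
  have "eventually (\<lambda>(r, n). norm (a r n) \<le> M r) (at_top \<times>\<^sub>F sequentially)"
    unfolding eventually_prod_sequentially using bound by (intro exI[of _ 1]) auto
  moreover have "summable M"
  proof -
    have "M = (\<lambda>r. inverse (fact r) * (2 * exp (1 - c)) ^ r)"
      by (simp add: M_def power_mult_distrib divide_inverse mult_ac flip: exp_of_nat_mult)
    then show ?thesis using summable_exp[of "2 * exp (1 - c)"] by simp
  qed
  ultimately have "(\<lambda>n. \<Sum>r. a r n) \<longlonglongrightarrow> (\<Sum>r. b r)"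
    using tannerys_theorem[OF lim] by simp
  moreover have "(\<Sum>r. a r n) = empty_prob n (k n) j" for n
  proof -
    have "(\<Sum>r. a r n) = (\<Sum>r\<le>n. a r n)" by (intro suminf_finite) (auto simp: a_def)
    then show ?thesis by (simp add: a_def empty_prob_def mult.assoc)
  qed
  \<comment> \<open>The terms below \<open>j\<close> vanish; shifted by \<open>j\<close>, the series
    is \<open>\<mu> ^ j / fact j\<close> times that of \<open>exp (- \<mu>)\<close>.\<close>
  moreover have "b sums (exp (- \<mu>) * \<mu> ^ j / fact j)"
  proof -
    have "(\<lambda>i. (- \<mu>) ^ i / fact i) sums exp (- \<mu>)"
      using exp_converges[of "- \<mu>"] by (simp add: divide_inverse mult.commute)
    then have "(\<lambda>i. \<mu> ^ j / fact j * ((- \<mu>) ^ i / fact i)) sums (\<mu> ^ j / fact j * exp (- \<mu>))"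
      by (rule sums_mult)
    moreover have "b (i + j) = \<mu> ^ j / fact j * ((- \<mu>) ^ i / fact i)" for i
    proof -
      have "real ((i + j) choose j) = fact (i + j) / (fact j * fact i)"
        by (subst binomial_fact) auto
      then have "b (i + j) = ((-1) ^ (i + j + j) * \<mu> ^ (i + j)) / (fact j * fact i)"
        by (simp add: b_def)
      also have "(-1) ^ (i + j + j) = (-1 :: real) ^ i"
        by (simp add: power_add mult.assoc flip: power_mult_distrib)
      also have "(-1) ^ i * \<mu> ^ (i + j) = (- \<mu>) ^ i * \<mu> ^ j"
        by (subst power_minus) (simp add: power_add)
      finally show ?thesis by simp
    qed
    ultimately have "(\<lambda>i. b (i + j)) sums (\<mu> ^ j / fact j * exp (- \<mu>))" by simp
    moreover have "(\<Sum>i<j. b i) = 0" by (intro sum.neutral) (simp add: b_def binomial_eq_0)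
    ultimately show ?thesis by (simp add: sums_iff_shift mult.commute)
  qed
  ultimately show ?thesis by (simp add: sums_iff \<mu>_def)
qed

text \<open>The limiting density relative to the uniform distribution on words whose maximal sorted
  tail has length \<open>j\<close>: the Poisson weights
  \<open>exp (- \<mu>) * \<mu> ^ i / fact i\<close> times \<open>fact i * p ^ i\<close>, summed over
  \<open>i \<le> j\<close>.\<close>

definition limit_density :: "nat \<Rightarrow> real \<Rightarrow> nat \<Rightarrow> real" where
  "limit_density p \<mu> j = exp (- \<mu>) * (\<Sum>i\<le>j. (\<mu> * real p) ^ i)"

definition limit_tv :: "nat \<Rightarrow> real \<Rightarrow> real" where
  "limit_tv p \<mu> = (\<Sum>j. tail_weight p j * max 0 (1 - limit_density p \<mu> j))"

lemma limit_density_ge: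
  assumes "\<mu> \<ge> 0"
  shows "limit_density p \<mu> j \<ge> exp (- \<mu>)"
proof -
  have "(\<mu> * real p) ^ 0 \<le> (\<Sum>i\<le>j. (\<mu> * real p) ^ i)"
    using assms by (intro member_le_sum) auto
  then show ?thesis unfolding limit_density_def by simp
qed

text \<open>The density is at least \<open>exp (- \<mu>)\<close>, so every deficit is at most
  \<open>1 - exp (- \<mu>) \<le> \<mu>\<close>, and the weights sum to 1. For positivity a single
  positive term suffices.\<close>

lemma limit_tv_bounds:
  assumes "p \<ge> 1" "\<mu> > 0"
  shows "summable (\<lambda>j. tail_weight p j * max 0 (1 - limit_density p \<mu> j))"
    and "limit_tv p \<mu> \<le> \<mu>" and "limit_tv p \<mu> > 0"
proof -
  let ?u = "\<lambda>j. tail_weight p j * max 0 (1 - limit_density p \<mu> j)"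
  have nonneg: "?u j \<ge> 0" for j using tail_weight_nonneg[OF assms(1)] by simp
  have le: "?u j \<le> tail_weight p j * \<mu>" for j
  proof (rule mult_left_mono[OF _ tail_weight_nonneg[OF assms(1)]])
    have "1 - \<mu> \<le> exp (- \<mu>)" using exp_ge_add_one_self[of "- \<mu>"] by simp
    then show "max 0 (1 - limit_density p \<mu> j) \<le> \<mu>"
      using limit_density_ge[of \<mu> p j] assms by simp
  qed
  have sums: "(\<lambda>j. tail_weight p j * \<mu>) sums (1 * \<mu>)"
    by (intro sums_mult2 tail_weight_sums assms)
  show summ: "summable ?u"
    using sums_summable[OF sums] nonneg le by (intro summable_comparison_test'[of "\<lambda>j. tail_weight p j * \<mu>" 0 ?u]) auto
  show "limit_tv p \<mu> \<le> \<mu>"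
    unfolding limit_tv_def using suminf_le[OF le summ sums_summable[OF sums]] sums_unique[OF sums] by simp
  \<comment> \<open>For \<open>p = 1\<close> the weight at 0 is 0, so \<open>j = 1\<close> serves,
    with density \<open>(1 + \<mu>) exp (- \<mu>) < 1\<close>. For \<open>p \<ge> 2\<close> already
    \<open>j = 0\<close> has positive weight, with density \<open>exp (- \<mu>)\<close>.\<close>
  have "\<exists>j. ?u j > 0"
  proof (cases "p = 1")
    case True
    have "\<mu>\<^sup>2 > 0" using assms by simp
    then have "exp \<mu> > 1 + \<mu>" using exp_lower_Taylor_quadratic[of \<mu>] assms by linarith
    then have "limit_density p \<mu> 1 < 1"
      using True by (simp add: limit_density_def exp_minus field_simps)
    then have "?u 1 > 0" using True by (simp add: tail_weight_def)
    then show ?thesis ..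
  next
    case False
    then have "p \<ge> 2" using assms by simp
    then have "?u 0 > 0" using assms by (simp add: tail_weight_def limit_density_def)
    then show ?thesis ..
  qed
  then obtain j where "?u j > 0" ..
  then show "limit_tv p \<mu> > 0" unfolding limit_tv_def by (intro suminf_pos2[OF summ nonneg])
qed

text \<open>Each summand of \<open>tv_eq\<close> converges by the Poisson limit and is dominated by
  \<open>tail_weight p j\<close>, which is summable, so Tannery's theorem applies again.\<close>

lemma tv_tendsto_limit_tv:
  fixes c :: real
  assumes p: "p \<ge> 1"
  defines "k \<equiv> \<lambda>n. nat \<lfloor>real n * ln (real n) + c * real n\<rfloor>"
  shows "(\<lambda>n. tv_after_shuffles n p (k n)) \<longlonglongrightarrow> limit_tv p (exp (- c))"
proof -
  define R where "R = (\<lambda>n j. \<Sum>i\<le>j. empty_prob n (k n) i * (fact i * real p ^ i))"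
  define a where "a = (\<lambda>j n. if 1 \<le> n \<and> j < n then tail_weight p j * max 0 (1 - R n j) else 0)"
  have R_nonneg: "R n j \<ge> 0" if "n \<ge> 1" for n j
    using that by (auto simp: R_def intro!: sum_nonneg mult_nonneg_nonneg empty_prob_nonneg)
  have R: "(\<lambda>n. R n j) \<longlonglongrightarrow> limit_density p (exp (- c)) j" for j
  proof -
    have "(\<lambda>n. R n j) \<longlonglongrightarrow> (\<Sum>i\<le>j. exp (- exp (- c)) * exp (- c) ^ i / fact i * (fact i * real p ^ i))"
      unfolding R_def by (intro tendsto_intros empty_prob_tendsto_Poisson) (simp add: k_def)
    also have "(\<Sum>i\<le>j. exp (- exp (- c)) * exp (- c) ^ i / fact i * (fact i * real p ^ i)) = limit_density p (exp (- c)) j"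
      by (simp add: limit_density_def sum_distrib_left power_mult_distrib mult_ac)
    finally show ?thesis .
  qed
  have "(\<lambda>n. a j n) \<longlonglongrightarrow> tail_weight p j * max 0 (1 - limit_density p (exp (- c)) j)" for j
  proof (rule Lim_transform_eventually)
    show "(\<lambda>n. tail_weight p j * max 0 (1 - R n j)) \<longlonglongrightarrow> tail_weight p j * max 0 (1 - limit_density p (exp (- c)) j)"
      by (intro tendsto_intros R)
    show "\<forall>\<^sub>F n in sequentially. tail_weight p j * max 0 (1 - R n j) = a j n"
      using eventually_gt_at_top[of j] by eventually_elim (simp add: a_def)
  qed
  moreover have "eventually (\<lambda>(j, n). norm (a j n) \<le> tail_weight p j) (at_top \<times>\<^sub>F sequentially)"
    using R_nonneg tail_weight_nonneg[OF p]
    by (intro always_eventually) (auto simp: a_def abs_mult intro!: mult_left_le)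
  ultimately have lim: "(\<lambda>n. \<Sum>j. a j n) \<longlonglongrightarrow> limit_tv p (exp (- c))"
    using tannerys_theorem[of a _ sequentially "tail_weight p"] tail_weight_sums[OF p]
    by (auto simp: limit_tv_def sums_iff)
  \<comment> \<open>The contribution of the identity, at most \<open>1 / fact n\<close>.\<close>
  define e where "e = (\<lambda>n. max 0 (1 - R n n) / (fact n * real p ^ n))"
  have "e \<longlonglongrightarrow> 0"
  proof (rule tendsto_sandwich[OF _ _ tendsto_const])
    show "(\<lambda>n. 1 / fact n :: real) \<longlonglongrightarrow> 0"
      using summable_LIMSEQ_zero[OF summable_exp[of "1::real"]] by (simp add: inverse_eq_divide)
    show "\<forall>\<^sub>F n in sequentially. e n \<le> 1 / fact n"
      using eventually_ge_at_top[of 1]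
    proof eventually_elim
      case (elim n)
      have "real p ^ n \<ge> 1" using p by (simp add: one_le_power)
      then show ?case unfolding e_def using R_nonneg[OF elim, of n] by (intro frac_le) auto
    qed
    show "\<forall>\<^sub>F n in sequentially. 0 \<le> e n" by (simp add: e_def)
  qed
  with lim have "(\<lambda>n. (\<Sum>j. a j n) + e n) \<longlonglongrightarrow> limit_tv p (exp (- c)) + 0"
    by (rule tendsto_add)
  moreover have "\<forall>\<^sub>F n in sequentially. (\<Sum>j. a j n) + e n = tv_after_shuffles n p (k n)"
    using eventually_ge_at_top[of 1]
  proof eventually_elim
    case (elim n)
    interpret shuffle n p using p elim by unfold_locales
    have "(\<Sum>j. a j n) = (\<Sum>j<n. a j n)" by (intro suminf_finite) (auto simp: a_def)
    then show ?case using elim by (simp add: tv_eq a_def e_def R_def)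
  qed
  ultimately show ?thesis by (auto intro: Lim_transform_eventually)
qed

section \<open>Lower bound before the cutoff\<close>

text \<open>A single term of the exponential series is at most its sum.\<close>

lemma power_le_exp_times_fact:
  fixes x :: real
  assumes "x \<ge> 0"
  shows "x ^ m \<le> exp x * fact m"
proof -
  have "(\<Sum>i\<in>{m}. inverse (fact i) * x ^ i) \<le> (\<Sum>i. inverse (fact i) * x ^ i)"
    using assms by (intro sum_le_suminf summable_exp) auto
  also have "\<dots> = exp x" by (simp add: exp_def divide_inverse scaleR_conv_of_real)
  finally show ?thesis by (simp add: field_simps)
qed

context shuffle
begin

text \<open>Chernoff's bound for fewer than \<open>J\<close> empty boxes:
  \<open>1 \<le> 2 ^ J * (1 / 2) ^ j\<close> for \<open>j < J\<close> brings in the generating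
  function at \<open>1 / 2\<close>, which is at most \<open>(1 - q / 2) ^ n\<close>.\<close>

lemma tv_ge_exp:
  fixes k :: nat
  defines "q \<equiv> (1 - 1 / real n) ^ k"
  assumes "J \<le> n"
  shows "tv_after_shuffles n p k \<ge> 1 - 1 / fact J - 2 ^ J * exp (- real n * q / 2)"
proof -
  have q: "0 \<le> q" "q \<le> 1"
    using n by (auto simp: q_def intro!: zero_le_power power_le_one)
  have "(\<Sum>j<J. empty_prob n k j) \<le> (\<Sum>j<J. 2 ^ J * (empty_prob n k j * (1 / 2) ^ j))"
  proof (rule sum_mono)
    fix j assume "j \<in> {..<J}"
    then have "(2::real) ^ j \<le> 2 ^ J" by (intro power_increasing) auto
    then have "1 \<le> (2::real) ^ J * (1 / 2) ^ j" by (simp add: power_one_over)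
    then show "empty_prob n k j \<le> 2 ^ J * (empty_prob n k j * (1 / 2) ^ j)"
      using mult_left_mono[OF _ empty_prob_nonneg[OF n, of k j]] by (metis mult.left_commute mult.right_neutral)
  qed
  also have "\<dots> \<le> 2 ^ J * (\<Sum>j\<le>n. empty_prob n k j * (1 / 2) ^ j)"
    unfolding sum_distrib_left[symmetric] using assms empty_prob_nonneg[OF n]
    by (intro mult_left_mono sum_mono2) auto
  also have "\<dots> \<le> 2 ^ J * (1 - (1 - 1 / 2) * q) ^ n"
    unfolding q_def by (intro mult_left_mono empty_prob_gf_le n) auto
  also have "(1 - (1 - 1 / 2) * q) ^ n \<le> exp (- q / 2) ^ n"
    using q exp_ge_add_one_self[of "- q / 2"] by (intro power_mono) auto
  also have "exp (- q / 2) ^ n = exp (- real n * q / 2)"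
    by (simp flip: exp_of_nat_mult)
  finally have 1: "(\<Sum>j<J. empty_prob n k j) \<le> 2 ^ J * exp (- real n * q / 2)"
    by simp
  have "real p ^ J \<ge> 1" using p by (simp add: one_le_power)
  then have "1 / (fact J * real p ^ J) \<le> 1 / fact J"
    by (intro frac_le) (auto simp: mult_le_cancel_left1)
  with 1 tv_ge[OF assms(2), of k] show ?thesis by linarith
qed

end

text \<open>The left side is the expected number of empty boxes. In
  \<open>ln (1 - x) \<ge> - x - 2 x^2\<close> at \<open>x = 1 / n\<close>, valid as
  \<open>n \<ge> 2\<close>, the quadratic term costs at most \<open>2 (ln n - c) / n \<le> 2\<close>
  in the exponent.\<close>

lemma power_one_minus_inverse_ge:
  fixes c :: real
  assumes "n \<ge> 2" "c \<ge> 0" "real k \<le> real n * ln (real n) - c * real n"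
  shows "real n * (1 - 1 / real n) ^ k \<ge> exp (c - 2)"
proof -
  have ln: "ln (real n) \<le> real n" using assms(1) ln_le_minus_one[of "real n"] by simp
  have "- (1 / real n) - 2 * (1 / real n)\<^sup>2 \<le> ln (1 - 1 / real n)"
    using assms(1) by (intro ln_one_minus_pos_lower_bound) auto
  then have "(- (1 / real n) - 2 * (1 / real n)\<^sup>2) * real k \<le> ln (1 - 1 / real n) * real k"
    by (rule mult_right_mono) simp
  moreover have "(1 / real n + 2 * (1 / real n)\<^sup>2) * real k
      \<le> (1 / real n + 2 * (1 / real n)\<^sup>2) * (real n * ln (real n) - c * real n)"
    using assms(3) by (intro mult_left_mono) auto
  moreover have "(1 / real n + 2 * (1 / real n)\<^sup>2) * (real n * ln (real n) - c * real n)
      = ln (real n) - c + 2 * (ln (real n) - c) / real n"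
    using assms(1) by (simp add: field_simps power2_eq_square)
  moreover have "2 * (ln (real n) - c) / real n \<le> 2"
    using ln assms(1,2) by (simp add: field_simps)
  ultimately have "c - 2 - ln (real n) \<le> ln (1 - 1 / real n) * real k"
    by (simp add: algebra_simps)
  then have "exp (c - 2 - ln (real n)) \<le> exp (ln (1 - 1 / real n) * real k)" by simp
  also have "\<dots> = (1 - 1 / real n) ^ k"
    using assms(1) by (simp add: exp_of_nat_mult mult.commute)
  finally have "exp (c - 2 - ln (real n)) \<le> (1 - 1 / real n) ^ k" .
  moreover have "exp (c - 2 - ln (real n)) = exp (c - 2) / real n"
    using assms(1) by (simp only: exp_diff[of _ "ln (real n)"]) simp
  ultimately show ?thesis using assms(1) by (simp add: pos_divide_le_eq mult.commute)
qed

text \<open>With \<open>J = \<lceil>ln n\<rceil>\<close>, \<open>1 / fact J\<close> is of order at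
  most \<open>1 / n\<close> while \<open>2 ^ J\<close> is only polynomial in \<open>n\<close>. The
  hypothesis on \<open>c\<close> gives \<open>exp (c n) \<ge> ln (n p) ln n \<ge> (ln n)^2\<close>,
  hence at least \<open>exp (- 2) (ln n)^2\<close> empty boxes on average.\<close>

lemma tv_lower_bound:
  fixes c :: "nat \<Rightarrow> real"
  assumes p: "p \<ge> 1"
    and c: "\<And>n. n \<ge> 2 \<Longrightarrow> ln (ln (real (n * p)) * ln (real n)) \<le> c n"
    and c0: "(\<lambda>n. c n / ln (real n)) \<longlonglongrightarrow> 0"
  shows "\<forall>\<^sub>F n in sequentially.
    tv_after_shuffles n p (nat \<lfloor>real n * ln (real n) - c n * real n\<rfloor>)
      \<ge> 1 - (exp (exp 1) / real n + 2 * 2 powr ln (real n) * exp (- exp (- 2) * (ln (real n))\<^sup>2 / 2))"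
proof -
  have "\<forall>\<^sub>F n in sequentially. c n / ln (real n) < 1"
    using c0 by (rule order_tendstoD) simp
  moreover have "\<forall>\<^sub>F n in sequentially. ln (real n) \<ge> 1" by real_asymp
  ultimately show ?thesis using eventually_ge_at_top[of 2]
  proof eventually_elim
    case (elim n)
    interpret shuffle n p using p elim by unfold_locales auto
    define k where "k = nat \<lfloor>real n * ln (real n) - c n * real n\<rfloor>"
    define J where "J = nat \<lceil>ln (real n)\<rceil>"
    \<comment> \<open>Makes \<open>n ln n - c n * n\<close> nonnegative; otherwise truncation at 0
      would push \<open>k\<close> above it.\<close>
    have "c n < ln (real n)" using elim by (simp add: field_simps)
    then have "c n * real n \<le> ln (real n) * real n" by (intro mult_right_mono) auto
    then have k: "real k \<le> real n * ln (real n) - c n * real n"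
      unfolding k_def by (simp add: mult.commute)
    have "real n \<le> real (n * p)" using mult_le_mono2[OF p, of n] by (simp only: of_nat_le_iff mult_1_right)
    then have "ln (real n) \<le> ln (real (n * p))" using elim p by (subst ln_le_cancel_iff) auto
    then have sq: "(ln (real n))\<^sup>2 \<le> ln (real (n * p)) * ln (real n)"
      unfolding power2_eq_square using elim by (intro mult_right_mono) auto
    have "1 \<le> (ln (real n))\<^sup>2" using elim by (simp add: one_le_power)
    \<comment> \<open>Keeps the argument of the outer logarithm at least 1, so that
      \<open>c n \<ge> 0\<close> and the logarithm can be undone by \<open>exp\<close>.\<close>
    with sq have pos: "1 \<le> ln (real (n * p)) * ln (real n)" by linarith
    then have c_nonneg: "c n \<ge> 0" using c[of n] elim ln_ge_zero[OF pos] by linarith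
    have "ln (real (n * p)) * ln (real n) \<le> exp (c n)"
    proof -
      have "exp (ln (ln (real (n * p)) * ln (real n))) \<le> exp (c n)"
        using c[of n] elim by (intro exp_le_cancel_iff[THEN iffD2])
      then show ?thesis using pos by (subst (asm) exp_ln) auto
    qed
    with sq have "(ln (real n))\<^sup>2 * exp (- 2) \<le> exp (c n) * exp (- 2)"
      by (intro mult_right_mono) auto
    also have "\<dots> \<le> real n * (1 - 1 / real n) ^ k"
      using power_one_minus_inverse_ge[OF _ c_nonneg k] elim by (simp add: exp_diff exp_minus divide_inverse)
    finally have "exp (- real n * (1 - 1 / real n) ^ k / 2) \<le> exp (- exp (- 2) * (ln (real n))\<^sup>2 / 2)"
      by (simp add: mult.commute)
    moreover have "(2::real) ^ J \<le> 2 * 2 powr ln (real n)"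
    proof -
      have "real J \<le> ln (real n) + 1" using elim unfolding J_def by linarith
      then have "2 powr real J \<le> 2 powr (ln (real n) + 1)" by (intro powr_mono) auto
      then show ?thesis by (simp add: powr_realpow powr_add mult.commute)
    qed
    ultimately have "2 ^ J * exp (- real n * (1 - 1 / real n) ^ k / 2)
        \<le> 2 * 2 powr ln (real n) * exp (- exp (- 2) * (ln (real n))\<^sup>2 / 2)"
      by (intro mult_mono) auto
    moreover have "1 / fact J \<le> exp (exp 1) / real n"
    proof -
      have "real n = exp (ln (real n))" using elim by simp
      also have "\<dots> \<le> exp (real J)" unfolding J_def exp_le_cancel_iff by linarith
      also have "\<dots> = exp 1 ^ J" by (simp flip: exp_of_nat_mult)
      also have "\<dots> \<le> exp (exp 1) * fact J" by (rule power_le_exp_times_fact) simp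
      finally show ?thesis using elim by (simp add: field_simps)
    qed
    moreover have "J \<le> n"
      using elim ln_le_minus_one[of "real n"] unfolding J_def by linarith
    note tv_ge_exp[OF this, of k]
    ultimately show ?case unfolding k_def[symmetric] by linarith
  qed
qed

text \<open>\<open>2 powr ln n\<close> is a fixed power of \<open>n\<close>, and
  \<open>exp (- C (ln n)^2)\<close> with \<open>C > 0\<close> decays faster than every power, so the
  whole error is \<open>O(1 / n)\<close>.\<close>

lemma bigo_lower_bound_error:
  fixes \<delta> :: real
  assumes "\<delta> > 0"
  shows "(\<lambda>n. exp (exp 1) / real n + 2 * 2 powr ln (real n) * exp (- exp (- 2) * (ln (real n))\<^sup>2 / 2))
    \<in> O(\<lambda>n. 1 / real n powr (1 / 2 - \<delta>))"
proof -
  have "(\<lambda>n. exp (exp 1) / real n + 2 * 2 powr ln (real n) * exp (- exp (- 2) * (ln (real n))\<^sup>2 / 2))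
      \<in> O(\<lambda>n. 1 / real n)"
    by real_asymp
  also have "(\<lambda>n. 1 / real n) \<in> O(\<lambda>n. 1 / real n powr (1 / 2 - \<delta>))"
    using assms by real_asymp
  finally show ?thesis .
qed

theorem theorem2:
  fixes p :: nat
  assumes "p \<ge> 1"
  shows
    "(\<exists>f :: real \<Rightarrow> real.
       (\<forall>c>0. f c > 0 \<and>
          (\<lambda>n. tv_after_shuffles n p (nat \<lfloor>real n * ln (real n) + c * real n\<rfloor>) - f c) \<in> o(\<lambda>n. 1)) \<and>
       (\<exists>g. g \<in> O[at_top](\<lambda>c. exp (- 2 * c)) \<and> (\<forall>\<^sub>F c in at_top. f c \<le> exp (- c) + g c))) \<and>
     (\<forall>c :: nat \<Rightarrow> real.
       (\<forall>n\<ge>2. ln (ln (real (n * p)) * ln (real n)) \<le> c n) \<longrightarrow>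
       (\<lambda>n. c n / ln (real n)) \<longlonglongrightarrow> 0 \<longrightarrow>
       (\<forall>\<delta>>0. \<exists>h. h \<in> O(\<lambda>n. 1 / real n powr (1 / 2 - \<delta>)) \<and>
          (\<forall>\<^sub>F n in sequentially.
             tv_after_shuffles n p (nat \<lfloor>real n * ln (real n) - c n * real n\<rfloor>) \<ge> 1 - h n)))"
proof (intro conjI allI impI)
  have "(\<lambda>n. tv_after_shuffles n p (nat \<lfloor>real n * ln (real n) + c * real n\<rfloor>) - limit_tv p (exp (- c)))
      \<in> o(\<lambda>n. 1)" for c
    using tv_tendsto_limit_tv[OF assms, of c] by (intro smalloI_tendsto) (auto simp: LIM_zero)
  \<comment> \<open>The bound by \<open>exp (- c)\<close> holds for every \<open>c\<close>, so the
    zero function serves as \<open>g\<close>.\<close>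
  moreover have "limit_tv p (exp (- c)) > 0" "limit_tv p (exp (- c)) \<le> exp (- c) + 0" for c
    using limit_tv_bounds[OF assms, of "exp (- c)"] by auto
  ultimately show "\<exists>f :: real \<Rightarrow> real.
       (\<forall>c>0. f c > 0 \<and>
          (\<lambda>n. tv_after_shuffles n p (nat \<lfloor>real n * ln (real n) + c * real n\<rfloor>) - f c) \<in> o(\<lambda>n. 1)) \<and>
       (\<exists>g. g \<in> O[at_top](\<lambda>c. exp (- 2 * c)) \<and> (\<forall>\<^sub>F c in at_top. f c \<le> exp (- c) + g c))"
    by (intro exI[of _ "\<lambda>c. limit_tv p (exp (- c))"] conjI allI impI exI[of _ "\<lambda>_. 0"] always_eventually)
      auto
next
  fix c :: "nat \<Rightarrow> real" and \<delta> :: real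
  assume "\<forall>n\<ge>2. ln (ln (real (n * p)) * ln (real n)) \<le> c n" "(\<lambda>n. c n / ln (real n)) \<longlonglongrightarrow> 0" "\<delta> > 0"
  then show "\<exists>h. h \<in> O(\<lambda>n. 1 / real n powr (1 / 2 - \<delta>)) \<and>
      (\<forall>\<^sub>F n in sequentially.
         tv_after_shuffles n p (nat \<lfloor>real n * ln (real n) - c n * real n\<rfloor>) \<ge> 1 - h n)"
    using tv_lower_bound[OF assms, of c] bigo_lower_bound_error by blast
qed

end
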